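(* A countable linear ordering $(L,<)$ has a $\Sigma^{\mathrm{in}}_3$ Scott sentence if and only if its adjacency relation $\{(a,b)\in L^2 : a<b \text{ and there is no } c \text{ with } a<c<b\}$ is finite.
   Context: Infinitary formulas: $\Sigma^{\mathrm{in}}_0=\Pi^{\mathrm{in}}_0$ are the finitary quantifier-free formulas; for $\alpha\ge1$, a $\Sigma^{\mathrm{in}}_\alpha$ formula is a countable disjunction of formulas $\exists\bar x\,\varphi$ with $\varphi\in\Pi^{\mathrm{in}}_\beta$, $\beta<\alpha$, and $\Pi^{\mathrm{in}}_\alpha$ is dual. A Scott sentence of a countable structure is an $L_{\omega_1\omega}$ sentence whose countable models are exactly its isomorphic copies. *)

theory Defs
  imports Main "HOL-Library.Countable_Set"
begin

text \<open>
  Formulas of the infinitary logic over the language with one binary relation symbol (and equality).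
  \<open>Disj I \<Phi>\<close> and \<open>Conj I \<Phi>\<close> stand for the disjunction and conjunction of the countable family
  \<open>(\<Phi> i)\<^sub>i\<close>, \<open>i \<in> I\<close>; the finitary connectives are the instances with finite \<open>I\<close>.
  Quantifiers come in finite blocks, so every subformula of a sentence has only finitely many
  free variables, and finiteness of \<open>fv\<close> need not be imposed separately.
\<close>

datatype fm =
    Eq nat nat
  | Less nat nat
  | Neg fm
  | Disj "nat set" "nat \<Rightarrow> fm"
  | Conj "nat set" "nat \<Rightarrow> fm"
  | Exists nat fm
  | Forall nat fm

primrec fv :: "fm \<Rightarrow> nat set" where
  "fv (Eq x y) = {x, y}"
| "fv (Less x y) = {x, y}"
| "fv (Neg \<phi>) = fv \<phi>"
| "fv (Disj I \<Phi>) = (\<Union>i\<in>I. fv (\<Phi> i))"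
| "fv (Conj I \<Phi>) = (\<Union>i\<in>I. fv (\<Phi> i))"
| "fv (Exists x \<phi>) = fv \<phi> - {x}"
| "fv (Forall x \<phi>) = fv \<phi> - {x}"

primrec sat :: "'a set \<Rightarrow> 'a rel \<Rightarrow> (nat \<Rightarrow> 'a) \<Rightarrow> fm \<Rightarrow> bool" where
  "sat A R v (Eq x y) \<longleftrightarrow> v x = v y"
| "sat A R v (Less x y) \<longleftrightarrow> (v x, v y) \<in> R"
| "sat A R v (Neg \<phi>) \<longleftrightarrow> \<not> sat A R v \<phi>"
| "sat A R v (Disj I \<Phi>) \<longleftrightarrow> (\<exists>i\<in>I. sat A R v (\<Phi> i))"
| "sat A R v (Conj I \<Phi>) \<longleftrightarrow> (\<forall>i\<in>I. sat A R v (\<Phi> i))"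
| "sat A R v (Exists x \<phi>) \<longleftrightarrow> (\<exists>a\<in>A. sat A R (v(x := a)) \<phi>)"
| "sat A R v (Forall x \<phi>) \<longleftrightarrow> (\<forall>a\<in>A. sat A R (v(x := a)) \<phi>)"

inductive quantifier_free :: "fm \<Rightarrow> bool" where
  "quantifier_free (Eq x y)"
| "quantifier_free (Less x y)"
| "quantifier_free \<phi> \<Longrightarrow> quantifier_free (Neg \<phi>)"
| "finite I \<Longrightarrow> (\<And>i. i \<in> I \<Longrightarrow> quantifier_free (\<Phi> i)) \<Longrightarrow> quantifier_free (Disj I \<Phi>)"
| "finite I \<Longrightarrow> (\<And>i. i \<in> I \<Longrightarrow> quantifier_free (\<Phi> i)) \<Longrightarrow> quantifier_free (Conj I \<Phi>)"

text \<open>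
  The finite levels of the hierarchy of infinitary formulas. The tuples \<open>xs\<close> may be empty and may
  differ from one member of the family to the next, as may the level \<open>m\<close>.
\<close>

inductive Sigma_in :: "nat \<Rightarrow> fm \<Rightarrow> bool" and Pi_in :: "nat \<Rightarrow> fm \<Rightarrow> bool" where
  "quantifier_free \<phi> \<Longrightarrow> Sigma_in 0 \<phi>"
| "quantifier_free \<phi> \<Longrightarrow> Pi_in 0 \<phi>"
| "1 \<le> n \<Longrightarrow> (\<And>i. i \<in> I \<Longrightarrow> \<exists>m<n. \<exists>xs \<psi>. Pi_in m \<psi> \<and> \<Phi> i = foldr Exists xs \<psi>)
    \<Longrightarrow> Sigma_in n (Disj I \<Phi>)"
| "1 \<le> n \<Longrightarrow> (\<And>i. i \<in> I \<Longrightarrow> \<exists>m<n. \<exists>xs \<psi>. Sigma_in m \<psi> \<and> \<Phi> i = foldr Forall xs \<psi>)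
    \<Longrightarrow> Pi_in n (Conj I \<Phi>)"

definition sentence :: "fm \<Rightarrow> bool" where
  "sentence \<phi> \<longleftrightarrow> fv \<phi> = {}"

text \<open>
  Meant for sentences, whose truth value does not depend on \<open>v\<close>. The valuation is not
  required to take values in \<open>A\<close>, so that the empty structure is treated correctly.
\<close>

definition is_model :: "'a set \<Rightarrow> 'a rel \<Rightarrow> fm \<Rightarrow> bool" where
  "is_model A R \<phi> \<longleftrightarrow> (\<forall>v. sat A R v \<phi>)"

definition isomorphic :: "'a set \<Rightarrow> 'a rel \<Rightarrow> 'b set \<Rightarrow> 'b rel \<Rightarrow> bool" where
  "isomorphic A R B S \<longleftrightarrow>
    (\<exists>f. bij_betw f A B \<and> (\<forall>x\<in>A. \<forall>y\<in>A. (x, y) \<in> R \<longleftrightarrow> (f x, f y) \<in> S))"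

text \<open>
  Every countable structure has a copy whose universe is a set of natural numbers, so it suffices
  to range over these; \<open>scott_sentence_iff\<close> below recovers countable models over any type.
\<close>

definition scott_sentence :: "'a set \<Rightarrow> 'a rel \<Rightarrow> fm \<Rightarrow> bool" where
  "scott_sentence A R \<phi> \<longleftrightarrow> sentence \<phi> \<and>
    (\<forall>(B :: nat set) S. S \<subseteq> B \<times> B \<longrightarrow> (is_model B S \<phi> \<longleftrightarrow> isomorphic A R B S))"

definition adjacency :: "'a set \<Rightarrow> 'a rel \<Rightarrow> 'a rel" where
  "adjacency L R =
    {(a, b). a \<in> L \<and> b \<in> L \<and> (a, b) \<in> R \<and> \<not> (\<exists>c\<in>L. (a, c) \<in> R \<and> (c, b) \<in> R)}"

lemma sat_isomorphism:
  assumes f: "bij_betw f A B" and R: "\<forall>x\<in>A. \<forall>y\<in>A. (x, y) \<in> R \<longleftrightarrow> (f x, f y) \<in> S"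
    and "\<forall>x\<in>fv \<phi>. v x \<in> A \<and> w x = f (v x)"
  shows "sat A R v \<phi> \<longleftrightarrow> sat B S w \<phi>"
  using assms(3)
proof (induction \<phi> arbitrary: v w)
  case (Eq x y)
  then show ?case using f by (auto simp: bij_betw_def inj_on_def)
next
  case (Less x y)
  then show ?case using R by auto
next
  case (Neg \<phi>)
  then show ?case by auto
next
  case (Disj I \<Phi>)
  have "sat A R v (\<Phi> i) \<longleftrightarrow> sat B S w (\<Phi> i)" if "i \<in> I" for i
    by (rule Disj.IH) (use Disj.prems that in auto)
  then show ?case by simp
next
  case (Conj I \<Phi>)
  have "sat A R v (\<Phi> i) \<longleftrightarrow> sat B S w (\<Phi> i)" if "i \<in> I" for i
    by (rule Conj.IH) (use Conj.prems that in auto)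
  then show ?case by simp
next
  case (Exists x \<phi>)
  have "sat A R (v(x := a)) \<phi> \<longleftrightarrow> sat B S (w(x := f a)) \<phi>" if "a \<in> A" for a
    by (rule Exists.IH) (use Exists.prems that in auto)
  moreover have "B = f ` A" using f by (simp add: bij_betw_def)
  ultimately show ?case by simp
next
  case (Forall x \<phi>)
  have "sat A R (v(x := a)) \<phi> \<longleftrightarrow> sat B S (w(x := f a)) \<phi>" if "a \<in> A" for a
    by (rule Forall.IH) (use Forall.prems that in auto)
  moreover have "B = f ` A" using f by (simp add: bij_betw_def)
  ultimately show ?case by simp
qed

lemma is_model_isomorphic:
  assumes "sentence \<phi>" "isomorphic A R B S"
  shows "is_model A R \<phi> \<longleftrightarrow> is_model B S \<phi>"
proof -
  obtain f where f: "bij_betw f A B" "\<forall>x\<in>A. \<forall>y\<in>A. (x, y) \<in> R \<longleftrightarrow> (f x, f y) \<in> S"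
    using assms(2) by (auto simp: isomorphic_def)
  have "sat A R v \<phi> \<longleftrightarrow> sat B S w \<phi>" for v w
    using sat_isomorphism[OF f, of \<phi> v w] assms(1) by (simp add: sentence_def)
  then show ?thesis by (auto simp: is_model_def)
qed

lemma isomorphic_sym:
  assumes "isomorphic A R B S"
  shows "isomorphic B S A R"
proof -
  obtain f where f: "bij_betw f A B" "\<forall>x\<in>A. \<forall>y\<in>A. (x, y) \<in> R \<longleftrightarrow> (f x, f y) \<in> S"
    using assms by (auto simp: isomorphic_def)
  have "bij_betw (inv_into A f) B A" by (rule bij_betw_inv_into[OF f(1)])
  moreover have "(x, y) \<in> S \<longleftrightarrow> (inv_into A f x, inv_into A f y) \<in> R" if "x \<in> B" "y \<in> B" for x y
  proof -
    have "inv_into A f x \<in> A" "inv_into A f y \<in> A"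
      using calculation that by (auto simp: bij_betw_def)
    then show ?thesis
      using f(2) bij_betw_inv_into_right[OF f(1)] that by metis
  qed
  ultimately show ?thesis unfolding isomorphic_def by blast
qed

lemma isomorphic_trans:
  assumes "isomorphic A R B S" "isomorphic B S C T"
  shows "isomorphic A R C T"
proof -
  obtain f g where f: "bij_betw f A B" "\<forall>x\<in>A. \<forall>y\<in>A. (x, y) \<in> R \<longleftrightarrow> (f x, f y) \<in> S"
    and g: "bij_betw g B C" "\<forall>x\<in>B. \<forall>y\<in>B. (x, y) \<in> S \<longleftrightarrow> (g x, g y) \<in> T"
    using assms unfolding isomorphic_def by blast
  have "bij_betw (g \<circ> f) A C" by (rule bij_betw_trans[OF f(1) g(1)])
  moreover have "\<forall>x\<in>A. \<forall>y\<in>A. (x, y) \<in> R \<longleftrightarrow> ((g \<circ> f) x, (g \<circ> f) y) \<in> T"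
    using f(2) g(2) bij_betw_apply[OF f(1)] by simp
  ultimately show ?thesis unfolding isomorphic_def by blast
qed

lemma countable_isomorphic_nat:
  assumes "countable A"
  shows "\<exists>(B :: nat set) S. S \<subseteq> B \<times> B \<and> isomorphic A R B S"
proof -
  obtain f :: "'a \<Rightarrow> nat" where f: "inj_on f A" using assms by (auto simp: countable_def)
  let ?S = "{(f x, f y) | x y. x \<in> A \<and> y \<in> A \<and> (x, y) \<in> R}"
  have "bij_betw f A (f ` A)" using f by (simp add: bij_betw_def)
  moreover have "\<forall>x\<in>A. \<forall>y\<in>A. (x, y) \<in> R \<longleftrightarrow> (f x, f y) \<in> ?S"
    using f by (auto dest: inj_onD)
  ultimately have "isomorphic A R (f ` A) ?S" unfolding isomorphic_def by blast
  moreover have "?S \<subseteq> f ` A \<times> f ` A" by auto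
  ultimately show ?thesis by blast
qed

lemma scott_sentence_iff:
  assumes "scott_sentence A R \<phi>" "countable B"
  shows "is_model B S \<phi> \<longleftrightarrow> isomorphic A R B S"
proof -
  obtain N :: "nat set" and T where T: "T \<subseteq> N \<times> N" "isomorphic B S N T"
    using countable_isomorphic_nat[OF assms(2)] by blast
  have "is_model B S \<phi> \<longleftrightarrow> is_model N T \<phi>"
    using is_model_isomorphic[OF _ T(2)] assms(1) by (simp add: scott_sentence_def)
  also have "\<dots> \<longleftrightarrow> isomorphic A R N T"
    using assms(1) T(1) by (simp add: scott_sentence_def)
  also have "\<dots> \<longleftrightarrow> isomorphic A R B S"
    by (rule iffI) (erule isomorphic_trans, rule isomorphic_sym[OF T(2)] T(2))+
  finally show ?thesis .
qed

end

theory Submission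
  imports Defs "HOL.Rat"
begin

text \<open>
  Suppose that \<open>\<exists>x \<psi>(x)\<close> is a disjunct of a \<open>\<Sigma>\<^sub>3\<close> Scott sentence of \<open>L\<close>, that \<open>\<psi>\<close> is \<open>\<Pi>\<^sub>2\<close>, and that
  the parameters \<open>a\<close> satisfy \<open>\<psi>\<close> in \<open>L\<close>. Replace every infinite interval between consecutive
  parameters by the rationals. Every finite tuple of the new order has the same order type over \<open>a\<close>
  as a tuple of \<open>L\<close>, and density provides the witnesses that exist in \<open>L\<close>. Hence the new order
  satisfies \<open>\<psi>(a)\<close>, so it is isomorphic to \<open>L\<close>; but it has only finitely many adjacencies.

  Conversely, if there are finitely many adjacencies, let \<open>a\<close> list their members together with
  the endpoints of \<open>L\<close>. All intervals between consecutive parameters are empty or dense without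
  endpoints, so \<open>L\<close> is homogeneous over \<open>a\<close>. The sentence stating which order types over \<open>a\<close> occur and
  how they extend is \<open>\<Pi>\<^sub>2\<close> over \<open>a\<close>, and by a back-and-forth argument it determines \<open>L\<close>.
\<close>

section \<open>Finite partial isomorphisms of linear orders\<close>

text \<open>A set of pairs rather than a function keeps the two sides symmetric and turns a
  one-point extension into \<open>insert\<close>. The equality clause makes \<open>g\<close> the
  graph of an injection.\<close>

definition partial_iso :: "'a rel \<Rightarrow> 'b rel \<Rightarrow> ('a \<times> 'b) set \<Rightarrow> bool" where
  "partial_iso R S g \<longleftrightarrow> (\<forall>(x, y)\<in>g. \<forall>(x', y')\<in>g.
    (x = x' \<longleftrightarrow> y = y') \<and> ((x, x') \<in> R \<longleftrightarrow> (y, y') \<in> S))"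

text \<open>The only points of a target order that can block a one-point extension: an adjacency
  leaves no room between its members, and an extreme point leaves none beyond it.\<close>

definition ends :: "'a set \<Rightarrow> 'a rel \<Rightarrow> 'a set" where
  "ends A R = Field (adjacency A R) \<union> {a\<in>A. \<forall>x\<in>A. (x, a) \<notin> R} \<union> {a\<in>A. \<forall>x\<in>A. (a, x) \<notin> R}"

text \<open>\<open>H\<close> anchors the maps: it pairs the points that must be respected throughout
  with their prescribed images.\<close>

definition partial_isos ::
  "'a set \<Rightarrow> 'a rel \<Rightarrow> 'b set \<Rightarrow> 'b rel \<Rightarrow> ('a \<times> 'b) set \<Rightarrow> ('a \<times> 'b) set set" where
  "partial_isos A R B S H = {g. finite g \<and> g \<subseteq> A \<times> B \<and> partial_iso R S g \<and> H \<subseteq> g}"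

lemma partial_isoD:
  assumes "partial_iso R S g" "(x, y) \<in> g" "(x', y') \<in> g"
  shows "x = x' \<longleftrightarrow> y = y'" "(x, x') \<in> R \<longleftrightarrow> (y, y') \<in> S"
  using assms by (auto simp: partial_iso_def)

lemma strict_linear_order_onD:
  assumes "strict_linear_order_on A R"
  shows "(x, y) \<in> R \<Longrightarrow> (y, z) \<in> R \<Longrightarrow> (x, z) \<in> R" "(x, x) \<notin> R"
    "x \<in> A \<Longrightarrow> y \<in> A \<Longrightarrow> x = y \<or> (x, y) \<in> R \<or> (y, x) \<in> R"
  using assms unfolding strict_linear_order_on_def trans_def irrefl_def total_on_def by blast+

lemma strict_linear_order_on_converse:
  assumes "strict_linear_order_on A R"
  shows "strict_linear_order_on A (R\<inverse>)"
  using assms unfolding strict_linear_order_on_def trans_def irrefl_def total_on_def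
  by (metis converse_iff)

lemma strict_linear_order_on_finite_greatest:
  assumes "strict_linear_order_on A R" "finite F" "F \<noteq> {}" "F \<subseteq> A"
  shows "\<exists>m\<in>F. \<forall>x\<in>F. x = m \<or> (x, m) \<in> R"
  using assms(2-4)
proof (induction F rule: finite_ne_induct)
  case (singleton x)
  then show ?case by simp
next
  case (insert x F)
  then obtain m where m: "m \<in> F" "\<forall>y\<in>F. y = m \<or> (y, m) \<in> R" by auto
  consider "(m, x) \<in> R" | "x = m \<or> (x, m) \<in> R"
    using strict_linear_order_onD(3)[OF assms(1), of m x] m(1) insert.prems by auto
  then show ?case
  proof cases
    case 1
    then have "\<forall>y\<in>insert x F. y = x \<or> (y, x) \<in> R"
      using m strict_linear_order_onD(1)[OF assms(1)] by (metis insert_iff)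
    then show ?thesis by blast
  next
    case 2
    then show ?thesis using m by blast
  qed
qed

lemma finite_ends:
  assumes "strict_linear_order_on A R" "finite (adjacency A R)"
  shows "finite (ends A R)"
proof -
  have "finite F" if "\<And>a b. a \<in> F \<Longrightarrow> b \<in> F \<Longrightarrow> a = b" for F :: "'a set"
  proof (cases "F = {}")
    case False
    then obtain a where "a \<in> F" by blast
    then have "F \<subseteq> {a}" using that by blast
    then show ?thesis by (rule finite_subset) simp
  qed simp
  \<comment> \<open>Linearity allows at most one least and one greatest point.\<close>
  from this[of "{a\<in>A. \<forall>x\<in>A. (x, a) \<notin> R}"] this[of "{a\<in>A. \<forall>x\<in>A. (a, x) \<notin> R}"]
  have "finite {a\<in>A. \<forall>x\<in>A. (x, a) \<notin> R}" "finite {a\<in>A. \<forall>x\<in>A. (a, x) \<notin> R}"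
    using strict_linear_order_onD(3)[OF assms(1)] by blast+
  then show ?thesis using assms(2) by (simp add: ends_def finite_Field)
qed

text \<open>
  Any two points of \<open>B\<close> that have to be separated by the image of \<open>x\<close> either have room between
  them, or are adjacent and hence anchored by \<open>H\<close>, in which case \<open>y\<^sub>0\<close> shows that they are not.
\<close>

lemma partial_iso_extend:
  assumes A: "strict_linear_order_on A R" and B: "strict_linear_order_on B S"
    and g: "finite g" "g \<subseteq> A \<times> B" "partial_iso R S g"
    and H: "H \<subseteq> g" "ends B S \<subseteq> Range H"
    and x: "x \<in> A"
    and y\<^sub>0: "y\<^sub>0 \<in> B" "\<And>k k'. (k, k') \<in> H \<Longrightarrow> (k, x) \<in> R \<Longrightarrow> (k', y\<^sub>0) \<in> S"
      "\<And>k k'. (k, k') \<in> H \<Longrightarrow> (x, k) \<in> R \<Longrightarrow> (y\<^sub>0, k') \<in> S"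
  shows "\<exists>y\<in>B. partial_iso R S (insert (x, y) g)"
proof (cases "x \<in> Domain g")
  case True
  then obtain y where "(x, y) \<in> g" by blast
  then have "y \<in> B" "insert (x, y) g = g" using g(2) by auto
  then show ?thesis using g(3) by metis
next
  case False
  note ordA = strict_linear_order_onD[OF A]
  note ordB = strict_linear_order_onD[OF B]
  \<comment> \<open>\<open>ends B S\<close> lies in the range of \<open>H\<close>, and
    \<open>g\<close> is injective, so a pair of \<open>g\<close> that hits it belongs to
    \<open>H\<close> already.\<close>
  have anchored: "(k, k') \<in> H" if k: "(k, k') \<in> g" "k' \<in> ends B S" for k k'
  proof -
    obtain j where "(j, k') \<in> H" using k(2) H(2) by blast
    then show ?thesis using partial_isoD(1)[OF g(3) k(1), of j k'] H(1) by auto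
  qed
  have between: "\<exists>y\<in>B. (l', y) \<in> S \<and> (y, h') \<in> S"
    if "(l, l') \<in> g" "(h, h') \<in> g" "(l, x) \<in> R" "(x, h) \<in> R" for l l' h h'
  proof (rule ccontr)
    assume contr: "\<not> ?thesis"
    have "(l', h') \<in> S" using that partial_isoD(2)[OF g(3)] ordA(1) by blast
    then have "(l', h') \<in> adjacency B S" using contr that g(2) by (auto simp: adjacency_def)
    then have "l' \<in> ends B S" "h' \<in> ends B S" by (auto simp: ends_def Field_def)
    then show False using contr anchored that y\<^sub>0 by blast
  qed
  have below: "\<exists>y\<in>B. (y, h') \<in> S" if "(h, h') \<in> g" "(x, h) \<in> R" for h h'
  proof (rule ccontr)
    assume contr: "\<not> ?thesis"
    then have "h' \<in> ends B S" using that g(2) by (auto simp: ends_def)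
    then show False using contr anchored that y\<^sub>0 by blast
  qed
  have above: "\<exists>y\<in>B. (l', y) \<in> S" if "(l, l') \<in> g" "(l, x) \<in> R" for l l'
  proof (rule ccontr)
    assume contr: "\<not> ?thesis"
    then have "l' \<in> ends B S" using that g(2) by (auto simp: ends_def)
    then show False using contr anchored that y\<^sub>0 by blast
  qed
  \<comment> \<open>Only the nearest points of the domain on either side of \<open>x\<close> matter:
    by monotonicity their images bound the images of all the others.\<close>
  let ?Lo = "{l \<in> Domain g. (l, x) \<in> R}" and ?Hi = "{h \<in> Domain g. (x, h) \<in> R}"
  have fin: "finite ?Lo" "finite ?Hi" using g(1) by (auto simp: finite_Domain)
  have sub: "?Lo \<subseteq> A" "?Hi \<subseteq> A" using g(2) by auto
  have lo: "\<exists>l l'. (l, l') \<in> g \<and> (l, x) \<in> R \<and> (\<forall>m m'. (m, m') \<in> g \<longrightarrow> (m, x) \<in> R \<longrightarrow> m' = l' \<or> (m', l') \<in> S)"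
    if ne: "?Lo \<noteq> {}"
  proof -
    obtain l where l: "l \<in> ?Lo" "\<forall>m\<in>?Lo. m = l \<or> (m, l) \<in> R"
      using strict_linear_order_on_finite_greatest[OF A fin(1) ne sub(1)] by blast
    then obtain l' where "(l, l') \<in> g" by blast
    then have "m' = l' \<or> (m', l') \<in> S" if "(m, m') \<in> g" "(m, x) \<in> R" for m m'
      using partial_isoD[OF g(3) that(1), of l l'] l(2) that by blast
    then show ?thesis using l(1) \<open>(l, l') \<in> g\<close> by blast
  qed
  have hi: "\<exists>h h'. (h, h') \<in> g \<and> (x, h) \<in> R \<and> (\<forall>m m'. (m, m') \<in> g \<longrightarrow> (x, m) \<in> R \<longrightarrow> m' = h' \<or> (h', m') \<in> S)"
    if ne: "?Hi \<noteq> {}"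
  proof -
    obtain h where h: "h \<in> ?Hi" "\<forall>m\<in>?Hi. m = h \<or> (m, h) \<in> R\<inverse>"
      using strict_linear_order_on_finite_greatest[OF strict_linear_order_on_converse[OF A] fin(2) ne sub(2)]
      by blast
    then obtain h' where "(h, h') \<in> g" by blast
    then have "m' = h' \<or> (h', m') \<in> S" if "(m, m') \<in> g" "(x, m) \<in> R" for m m'
      using partial_isoD[OF g(3), of h h' m m'] h(2) that by (auto dest!: bspec[of _ _ m])
    then show ?thesis using h(1) \<open>(h, h') \<in> g\<close> by blast
  qed
  have "\<exists>y\<in>B. (\<forall>m m'. (m, m') \<in> g \<longrightarrow> (m, x) \<in> R \<longrightarrow> (m', y) \<in> S) \<and>
      (\<forall>m m'. (m, m') \<in> g \<longrightarrow> (x, m) \<in> R \<longrightarrow> (y, m') \<in> S)"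
  proof (cases "?Lo = {}"; cases "?Hi = {}")
    assume "?Lo = {}" "?Hi = {}"
    then show ?thesis using y\<^sub>0(1) by blast
  next
    assume *: "?Lo = {}" "?Hi \<noteq> {}"
    then obtain h h' where h: "(h, h') \<in> g" "(x, h) \<in> R"
      "\<And>m m'. (m, m') \<in> g \<Longrightarrow> (x, m) \<in> R \<Longrightarrow> m' = h' \<or> (h', m') \<in> S" using hi by blast
    then obtain y where "y \<in> B" "(y, h') \<in> S" using below by blast
    then show ?thesis using h(3) ordB(1) * by blast
  next
    assume *: "?Lo \<noteq> {}" "?Hi = {}"
    then obtain l l' where l: "(l, l') \<in> g" "(l, x) \<in> R"
      "\<And>m m'. (m, m') \<in> g \<Longrightarrow> (m, x) \<in> R \<Longrightarrow> m' = l' \<or> (m', l') \<in> S" using lo by blast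
    then obtain y where "y \<in> B" "(l', y) \<in> S" using above by blast
    then show ?thesis using l(3) ordB(1) * by blast
  next
    assume *: "?Lo \<noteq> {}" "?Hi \<noteq> {}"
    obtain l l' where l: "(l, l') \<in> g" "(l, x) \<in> R"
      "\<And>m m'. (m, m') \<in> g \<Longrightarrow> (m, x) \<in> R \<Longrightarrow> m' = l' \<or> (m', l') \<in> S" using lo[OF *(1)] by blast
    obtain h h' where h: "(h, h') \<in> g" "(x, h) \<in> R"
      "\<And>m m'. (m, m') \<in> g \<Longrightarrow> (x, m) \<in> R \<Longrightarrow> m' = h' \<or> (h', m') \<in> S" using hi[OF *(2)] by blast
    obtain y where "y \<in> B" "(l', y) \<in> S" "(y, h') \<in> S" using between l h by blast
    then show ?thesis using l(3) h(3) ordB(1) by blast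
  qed
  then obtain y where y: "y \<in> B" "\<And>m m'. (m, m') \<in> g \<Longrightarrow> (m, x) \<in> R \<Longrightarrow> (m', y) \<in> S"
    "\<And>m m'. (m, m') \<in> g \<Longrightarrow> (x, m) \<in> R \<Longrightarrow> (y, m') \<in> S" by blast
  have new: "m \<noteq> x \<and> m' \<noteq> y \<and> ((m, x) \<in> R \<longleftrightarrow> (m', y) \<in> S) \<and> ((x, m) \<in> R \<longleftrightarrow> (y, m') \<in> S)"
    if m: "(m, m') \<in> g" for m m'
  proof -
    have "m \<noteq> x" using m False by blast
    then have "(m, x) \<in> R \<or> (x, m) \<in> R" using ordA(3)[of m x] m g(2) x by blast
    moreover have "\<not> ((m, x) \<in> R \<and> (x, m) \<in> R)" using ordA(1)[of m x m] ordA(2) by blast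
    moreover have "\<not> ((m', y) \<in> S \<and> (y, m') \<in> S)" using ordB(1)[of m' y m'] ordB(2) by blast
    ultimately show ?thesis using \<open>m \<noteq> x\<close> y(2,3)[OF m] ordB(2)[of y] by blast
  qed
  have "partial_iso R S (insert (x, y) g)"
    unfolding partial_iso_def
  proof (clarify)
    fix a a' b b'
    assume "(a, a') \<in> insert (x, y) g" "(b, b') \<in> insert (x, y) g"
    then show "(a = b \<longleftrightarrow> a' = b') \<and> ((a, b) \<in> R \<longleftrightarrow> (a', b') \<in> S)"
      using new[of a a'] new[of b b'] partial_isoD[OF g(3), of a a' b b'] ordA(2) ordB(2) by auto
  qed
  then show ?thesis using y(1) by blast
qed

lemma partial_isos_extend:
  assumes "strict_linear_order_on A R" "strict_linear_order_on B S" "ends B S \<subseteq> Range H"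
    and "g \<in> partial_isos A R B S H" "x \<in> A" "y\<^sub>0 \<in> B"
    and "\<And>k k'. (k, k') \<in> H \<Longrightarrow> (k, x) \<in> R \<Longrightarrow> (k', y\<^sub>0) \<in> S"
    and "\<And>k k'. (k, k') \<in> H \<Longrightarrow> (x, k) \<in> R \<Longrightarrow> (y\<^sub>0, k') \<in> S"
  shows "\<exists>y. insert (x, y) g \<in> partial_isos A R B S H"
proof -
  have g: "finite g" "g \<subseteq> A \<times> B" "partial_iso R S g" "H \<subseteq> g"
    using assms(4) by (auto simp: partial_isos_def)
  have "\<exists>y\<in>B. partial_iso R S (insert (x, y) g)"
    by (rule partial_iso_extend[OF assms(1,2) g assms(3,5,6)]) (blast intro: assms(7,8))+
  then obtain y where "y \<in> B" "partial_iso R S (insert (x, y) g)" by blast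
  then have "insert (x, y) g \<in> partial_isos A R B S H"
    using g assms(5) by (auto simp: partial_isos_def)
  then show ?thesis by blast
qed

text \<open>The anchors are fixed pointwise, so \<open>x\<close> itself can serve as the point
  \<open>y\<^sub>0\<close> of \<open>partial_isos_extend\<close>.\<close>

lemma partial_isos_extend_self:
  assumes "strict_linear_order_on A R" "ends A R \<subseteq> P"
    and "g \<in> partial_isos A R A R (Id_on P)" "x \<in> A"
  shows "\<exists>y. insert (x, y) g \<in> partial_isos A R A R (Id_on P)"
  by (rule partial_isos_extend[OF assms(1,1) _ assms(3,4,4)]) (use assms(2) in auto)

text \<open>Step \<open>n\<close> puts the elements with number \<open>n\<close>, if there are any,
  into the domain and the range. The union of the resulting chain is the isomorphism. The family
  \<open>G\<close> is arbitrary, so that it can later consist of zipped tuples.\<close>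

lemma isomorphic_back_and_forth:
  assumes "countable A" "countable B" "g\<^sub>0 \<in> G"
    and iso: "\<And>g. g \<in> G \<Longrightarrow> g \<subseteq> A \<times> B \<and> partial_iso R S g"
    and forward: "\<And>g x. g \<in> G \<Longrightarrow> x \<in> A \<Longrightarrow> \<exists>y. insert (x, y) g \<in> G"
    and backward: "\<And>g y. g \<in> G \<Longrightarrow> y \<in> B \<Longrightarrow> \<exists>x. insert (x, y) g \<in> G"
  shows "isomorphic A R B S"
proof -
  have into_domain: "\<exists>h\<in>G. g \<subseteq> h \<and> (\<forall>x\<in>A. to_nat_on A x = n \<longrightarrow> x \<in> Domain h)" if "g \<in> G" for g n
  proof (cases "\<exists>x\<in>A. to_nat_on A x = n")
    case True
    then obtain x where x: "x \<in> A" "to_nat_on A x = n" by blast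
    then obtain y where "insert (x, y) g \<in> G" using forward \<open>g \<in> G\<close> by blast
    moreover have "\<forall>z\<in>A. to_nat_on A z = n \<longrightarrow> z = x"
      using x assms(1) by (metis to_nat_on_inj)
    ultimately show ?thesis by (metis Domain_iff insertCI subset_insertI)
  qed (use that in blast)
  have into_range: "\<exists>h\<in>G. g \<subseteq> h \<and> (\<forall>y\<in>B. to_nat_on B y = n \<longrightarrow> y \<in> Range h)" if "g \<in> G" for g n
  proof (cases "\<exists>y\<in>B. to_nat_on B y = n")
    case True
    then obtain y where y: "y \<in> B" "to_nat_on B y = n" by blast
    then obtain x where "insert (x, y) g \<in> G" using backward \<open>g \<in> G\<close> by blast
    moreover have "\<forall>z\<in>B. to_nat_on B z = n \<longrightarrow> z = y"
      using y assms(2) by (metis to_nat_on_inj)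
    ultimately show ?thesis by (metis Range_iff insertCI subset_insertI)
  qed (use that in blast)
  have "\<exists>f. \<forall>n. f n \<in> G \<and> f n \<subseteq> f (Suc n) \<and>
      (\<forall>x\<in>A. to_nat_on A x = n \<longrightarrow> x \<in> Domain (f (Suc n))) \<and>
      (\<forall>y\<in>B. to_nat_on B y = n \<longrightarrow> y \<in> Range (f (Suc n)))"
  proof (rule dependent_nat_choice)
    show "\<exists>g. g \<in> G" using assms(3) by blast
    fix g n assume "g \<in> G"
    then obtain h where h: "h \<in> G" "g \<subseteq> h" "\<forall>x\<in>A. to_nat_on A x = n \<longrightarrow> x \<in> Domain h"
      using into_domain[of g n] by blast
    then obtain k where "k \<in> G" "h \<subseteq> k" "\<forall>y\<in>B. to_nat_on B y = n \<longrightarrow> y \<in> Range k"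
      using into_range[OF h(1), of n] by blast
    then show "\<exists>k. k \<in> G \<and> g \<subseteq> k \<and> (\<forall>x\<in>A. to_nat_on A x = n \<longrightarrow> x \<in> Domain k) \<and>
      (\<forall>y\<in>B. to_nat_on B y = n \<longrightarrow> y \<in> Range k)"
      using h by (intro exI[of _ k]) blast
  qed
  then obtain f :: "nat \<Rightarrow> ('a \<times> 'b) set" where f: "\<forall>n. f n \<in> G"
    "\<forall>n. f n \<subseteq> f (Suc n) \<and> (\<forall>x\<in>A. to_nat_on A x = n \<longrightarrow> x \<in> Domain (f (Suc n))) \<and>
      (\<forall>y\<in>B. to_nat_on B y = n \<longrightarrow> y \<in> Range (f (Suc n)))" by blast
  define U where "U = (\<Union>n. f n)"
  have mono: "f m \<subseteq> f n" if "m \<le> n" for m n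
    using lift_Suc_mono_le[of f] f(2) that by blast
  have U: "partial_iso R S U"
    unfolding partial_iso_def
  proof clarify
    fix x y x' y' assume "(x, y) \<in> U" "(x', y') \<in> U"
    then obtain m n where "(x, y) \<in> f m" "(x', y') \<in> f n" by (auto simp: U_def)
    then have "(x, y) \<in> f (max m n)" "(x', y') \<in> f (max m n)"
      using mono[of m "max m n"] mono[of n "max m n"] by auto
    then show "(x = x' \<longleftrightarrow> y = y') \<and> ((x, x') \<in> R \<longleftrightarrow> (y, y') \<in> S)"
      using partial_isoD[of R S "f (max m n)"] f(1) iso by blast
  qed
  have sub: "U \<subseteq> A \<times> B" using f(1) iso unfolding U_def by blast
  have dom: "\<exists>y. (x, y) \<in> U" if "x \<in> A" for x
  proof -
    have "x \<in> Domain (f (Suc (to_nat_on A x)))" using f(2) that by simp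
    then show ?thesis unfolding U_def by blast
  qed
  have ran: "\<exists>x. (x, y) \<in> U" if "y \<in> B" for y
  proof -
    have "y \<in> Range (f (Suc (to_nat_on B y)))" using f(2) that by simp
    then show ?thesis unfolding U_def by blast
  qed
  obtain h where h: "\<And>x. x \<in> A \<Longrightarrow> (x, h x) \<in> U" using dom by metis
  have "bij_betw h A B"
    unfolding bij_betw_def
  proof
    show "inj_on h A" using h partial_isoD(1)[OF U] by (metis inj_onI)
    show "h ` A = B"
    proof
      show "h ` A \<subseteq> B" using h sub by blast
      show "B \<subseteq> h ` A"
      proof
        fix y assume "y \<in> B"
        then obtain x where x: "(x, y) \<in> U" using ran by blast
        then have "x \<in> A" using sub by blast
        then have "h x = y" using partial_isoD(1)[OF U h x, of x] by simp
        then show "y \<in> h ` A" using \<open>x \<in> A\<close> by blast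
      qed
    qed
  qed
  moreover have "\<forall>x\<in>A. \<forall>y\<in>A. (x, y) \<in> R \<longleftrightarrow> (h x, h y) \<in> S"
    using h partial_isoD(2)[OF U] by blast
  ultimately show ?thesis unfolding isomorphic_def by blast
qed

section \<open>Preservation of infinitary formulas\<close>

text \<open>One final valuation replaces the chain of updates. This is right even if
  \<open>xs\<close> repeats a variable, since only the innermost value survives.\<close>

lemma sat_foldr_Exists:
  "sat A R v (foldr Exists xs \<phi>) \<longleftrightarrow>
    (\<exists>w. (\<forall>x. x \<notin> set xs \<longrightarrow> w x = v x) \<and> (\<forall>x\<in>set xs. w x \<in> A) \<and> sat A R w \<phi>)"
proof (induction xs arbitrary: v)
  case Nil
  have "(\<forall>x. w x = v x) \<longleftrightarrow> w = v" for w by auto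
  then show ?case by simp
next
  case (Cons x xs)
  show ?case
  proof
    assume "sat A R v (foldr Exists (x # xs) \<phi>)"
    then obtain a w where "a \<in> A" "\<forall>y. y \<notin> set xs \<longrightarrow> w y = (v(x := a)) y"
      "\<forall>y\<in>set xs. w y \<in> A" "sat A R w \<phi>"
      using Cons.IH by auto
    then show "\<exists>w. (\<forall>y. y \<notin> set (x # xs) \<longrightarrow> w y = v y) \<and> (\<forall>y\<in>set (x # xs). w y \<in> A) \<and> sat A R w \<phi>"
      by (intro exI[of _ w]) (auto split: if_splits)
  next
    assume "\<exists>w. (\<forall>y. y \<notin> set (x # xs) \<longrightarrow> w y = v y) \<and> (\<forall>y\<in>set (x # xs). w y \<in> A) \<and> sat A R w \<phi>"
    then obtain w where w: "\<forall>y. y \<notin> set (x # xs) \<longrightarrow> w y = v y" "\<forall>y\<in>set (x # xs). w y \<in> A"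
      "sat A R w \<phi>" by blast
    then have "sat A R (v(x := w x)) (foldr Exists xs \<phi>)"
      unfolding Cons.IH by (intro exI[of _ w]) auto
    then show "sat A R v (foldr Exists (x # xs) \<phi>)" using w(2) by auto
  qed
qed

lemma sat_foldr_Forall:
  "sat A R v (foldr Forall xs \<phi>) \<longleftrightarrow>
    (\<forall>w. (\<forall>x. x \<notin> set xs \<longrightarrow> w x = v x) \<longrightarrow> (\<forall>x\<in>set xs. w x \<in> A) \<longrightarrow> sat A R w \<phi>)"
proof -
  have "sat A R v (foldr Forall xs \<phi>) \<longleftrightarrow> \<not> sat A R v (foldr Exists xs (Neg \<phi>))"
    by (induction xs arbitrary: v) auto
  then show ?thesis by (auto simp: sat_foldr_Exists)
qed

lemma fv_foldr:
  "fv (foldr Exists xs \<phi>) = fv \<phi> - set xs" "fv (foldr Forall xs \<phi>) = fv \<phi> - set xs"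
  by (induction xs) auto

lemma quantifier_free_sat_iff:
  assumes "quantifier_free \<phi>" "partial_iso R S g" "\<forall>z\<in>fv \<phi>. (v z, w z) \<in> g"
  shows "sat A R v \<phi> \<longleftrightarrow> sat B S w \<phi>"
  using assms(1,3)
proof (induction rule: quantifier_free.induct)
  case (1 x y)
  then show ?case using partial_isoD(1)[OF assms(2)] by auto
next
  case (2 x y)
  then show ?case using partial_isoD(2)[OF assms(2)] by auto
qed auto

text \<open>Each witness in \<open>A\<close> is answered in \<open>B\<close> by a forward extension
  of the map, which finally decides the quantifier-free matrix. No backward extension is used, so
  truth passes from \<open>A\<close> to \<open>B\<close> only.\<close>

lemma sat_foldr_Exists_transfer:
  assumes "quantifier_free \<theta>" "g \<in> partial_isos A R B S H"
    and ext: "\<And>g x. g \<in> partial_isos A R B S H \<Longrightarrow> x \<in> A \<Longrightarrow> \<exists>y. insert (x, y) g \<in> partial_isos A R B S H"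
    and "\<forall>z\<in>fv (foldr Exists zs \<theta>). (v z, w z) \<in> g" "sat A R v (foldr Exists zs \<theta>)"
  shows "sat B S w (foldr Exists zs \<theta>)"
  using assms(2,4,5)
proof (induction zs arbitrary: g v w)
  case Nil
  then show ?case
    using quantifier_free_sat_iff[OF assms(1), of R S g v w] by (auto simp: partial_isos_def)
next
  case (Cons z zs)
  then obtain a where a: "a \<in> A" "sat A R (v(z := a)) (foldr Exists zs \<theta>)" by auto
  obtain b where b: "insert (a, b) g \<in> partial_isos A R B S H" using ext Cons.prems(1) a(1) by blast
  have "sat B S (w(z := b)) (foldr Exists zs \<theta>)"
    by (rule Cons.IH[OF b _ a(2)]) (use Cons.prems(2) in auto)
  moreover have "b \<in> B" using b by (auto simp: partial_isos_def)
  ultimately show ?case by auto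
qed

lemma Sigma_in_1_transfer:
  assumes "Sigma_in m \<chi>" "m \<le> 1" "g \<in> partial_isos A R B S H"
    and ext: "\<And>g x. g \<in> partial_isos A R B S H \<Longrightarrow> x \<in> A \<Longrightarrow> \<exists>y. insert (x, y) g \<in> partial_isos A R B S H"
    and "\<forall>z\<in>fv \<chi>. (v z, w z) \<in> g" "sat A R v \<chi>"
  shows "sat B S w \<chi>"
  using assms(1)
proof cases
  case 1
  then show ?thesis
    using quantifier_free_sat_iff[of \<chi> R S g v w] assms by (auto simp: partial_isos_def)
next
  case (2 I \<Phi>)
  then obtain i where i: "i \<in> I" "sat A R v (\<Phi> i)" using assms(6) by auto
  then obtain k zs \<theta> where \<theta>: "k < m" "Pi_in k \<theta>" "\<Phi> i = foldr Exists zs \<theta>" using 2 by blast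
  \<comment> \<open>From \<open>k < m\<close> and \<open>m \<le> 1\<close> follows
    \<open>k = 0\<close>.\<close>
  then have "quantifier_free \<theta>" using assms(2) by (auto elim: Pi_in.cases)
  moreover have "\<forall>z\<in>fv (\<Phi> i). (v z, w z) \<in> g" using assms(5) 2 i by auto
  ultimately have "sat B S w (\<Phi> i)"
    using sat_foldr_Exists_transfer[OF _ assms(3) ext] \<theta>(3) i(2) by metis
  then show ?thesis using 2 i by auto
qed

text \<open>Values in \<open>B\<close> for a universal block are pulled back to \<open>A\<close> by
  \<open>cover\<close>, and the existential formula that holds there is pushed forward by
  \<open>ext\<close>. \<open>cover\<close> treats the whole tuple at once, because preimages chosen
  one by one could be adjacent in \<open>A\<close> while further points have to fit between
  them.\<close>

lemma Pi_in_2_transfer: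
  assumes "Pi_in m \<psi>" "m \<le> 2"
    and ext: "\<And>g x. g \<in> partial_isos A R B S H \<Longrightarrow> x \<in> A \<Longrightarrow> \<exists>y. insert (x, y) g \<in> partial_isos A R B S H"
    and cover: "\<And>W. finite W \<Longrightarrow> W \<subseteq> B \<Longrightarrow> \<exists>g\<in>partial_isos A R B S H. W \<subseteq> Range g"
    and H: "\<forall>z\<in>fv \<psi>. (v z, w z) \<in> H" and sat: "sat A R v \<psi>"
  shows "sat B S w \<psi>"
  using assms(1)
proof cases
  case 1
  obtain g where "g \<in> partial_isos A R B S H" using cover[of "{}"] by auto
  then have "partial_iso R S g" "H \<subseteq> g" by (auto simp: partial_isos_def)
  then show ?thesis using quantifier_free_sat_iff[of \<psi> R S g v w A B] 1 H sat by blast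
next
  case (2 I \<Phi>)
  have "sat B S w (\<Phi> i)" if i: "i \<in> I" for i
  proof -
    obtain k ys \<chi> where \<chi>: "k < m" "Sigma_in k \<chi>" "\<Phi> i = foldr Forall ys \<chi>" using 2 i by blast
    have fv: "fv \<chi> \<subseteq> fv \<psi> \<union> set ys" using fv_foldr(2)[of ys \<chi>] \<chi>(3) 2 i by auto
    show ?thesis
      unfolding \<chi>(3) sat_foldr_Forall
    proof clarify
      fix w' assume w': "\<forall>x. x \<notin> set ys \<longrightarrow> w' x = w x" "\<forall>x\<in>set ys. w' x \<in> B"
      obtain g where g: "g \<in> partial_isos A R B S H" "w' ` set ys \<subseteq> Range g"
        using cover[of "w' ` set ys"] w'(2) by auto
      \<comment> \<open>Variables of the block receive some preimage under \<open>g\<close>; the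
        others keep their values, which \<open>H\<close> already pairs with those of
        \<open>w\<close>.\<close>
      define v' where "v' z = (if z \<in> set ys then SOME a. (a, w' z) \<in> g else v z)" for z
      have v'_ys: "(v' z, w' z) \<in> g" if "z \<in> set ys" for z
        using that g(2) someI_ex[of "\<lambda>a. (a, w' z) \<in> g"] by (auto simp: v'_def)
      have "sat A R v (foldr Forall ys \<chi>)" using sat 2 i \<chi>(3) by auto
      moreover have "\<forall>x\<in>set ys. v' x \<in> A" using v'_ys g(1) by (auto simp: partial_isos_def)
      ultimately have "sat A R v' \<chi>" by (auto simp: sat_foldr_Forall v'_def)
      moreover have "\<forall>z\<in>fv \<chi>. (v' z, w' z) \<in> g"
      proof
        fix z assume "z \<in> fv \<chi>"
        show "(v' z, w' z) \<in> g"
        proof (cases "z \<in> set ys")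
          case False
          then have "(v z, w z) \<in> g" using \<open>z \<in> fv \<chi>\<close> fv H g(1) by (auto simp: partial_isos_def)
          then show ?thesis using False w'(1) by (simp add: v'_def)
        qed (rule v'_ys)
      qed
      ultimately show "sat B S w' \<chi>"
        using Sigma_in_1_transfer[OF \<chi>(2) _ g(1) ext] \<chi>(1) assms(2) by simp
    qed
  qed
  then show ?thesis using 2 by simp
qed

section \<open>A Scott sentence for orders that are homogeneous over parameters\<close>

text \<open>\<open>Conj\<close> takes families indexed by naturals. Indexing by the image of
  \<open>F\<close> under \<open>to_nat_on F\<close> covers finite \<open>F\<close> as well and gives
  the empty family for empty \<open>F\<close>.\<close>

definition CONJ :: "fm set \<Rightarrow> fm" where
  "CONJ F = Conj (to_nat_on F ` F) (from_nat_into F)"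

definition DISJ :: "fm set \<Rightarrow> fm" where
  "DISJ F = Disj (to_nat_on F ` F) (from_nat_into F)"

lemma CONJ_simps:
  assumes "countable F"
  shows "sat A R v (CONJ F) \<longleftrightarrow> (\<forall>\<phi>\<in>F. sat A R v \<phi>)" "fv (CONJ F) = (\<Union>\<phi>\<in>F. fv \<phi>)"
    "finite F \<Longrightarrow> (\<And>\<phi>. \<phi> \<in> F \<Longrightarrow> quantifier_free \<phi>) \<Longrightarrow> quantifier_free (CONJ F)"
  using assms by (auto simp: CONJ_def intro!: quantifier_free.intros)

lemma DISJ_simps:
  assumes "countable F"
  shows "sat A R v (DISJ F) \<longleftrightarrow> (\<exists>\<phi>\<in>F. sat A R v \<phi>)" "fv (DISJ F) = (\<Union>\<phi>\<in>F. fv \<phi>)"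
  using assms by (auto simp: DISJ_def)

lemma Sigma_in_DISJ:
  assumes "countable F" "1 \<le> n"
    and "\<And>\<phi>. \<phi> \<in> F \<Longrightarrow> \<exists>m<n. \<exists>xs \<psi>. Pi_in m \<psi> \<and> \<phi> = foldr Exists xs \<psi>"
  shows "Sigma_in n (DISJ F)"
  unfolding DISJ_def by (rule Sigma_in_Pi_in.intros(3)[OF assms(2)]) (use assms(1,3) in auto)

lemma Pi_in_CONJ:
  assumes "countable F" "1 \<le> n"
    and "\<And>\<phi>. \<phi> \<in> F \<Longrightarrow> \<exists>m<n. \<exists>xs \<psi>. Sigma_in m \<psi> \<and> \<phi> = foldr Forall xs \<psi>"
  shows "Pi_in n (CONJ F)"
  unfolding CONJ_def by (rule Sigma_in_Pi_in.intros(4)[OF assms(2)]) (use assms(1,3) in auto)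

section \<open>Quantifier-free types of tuples\<close>

definition same_type :: "'a rel \<Rightarrow> 'b rel \<Rightarrow> 'a list \<Rightarrow> 'b list \<Rightarrow> bool" where
  "same_type R S xs ys \<longleftrightarrow> length xs = length ys \<and> (\<forall>i<length xs. \<forall>j<length xs.
    (xs ! i = xs ! j \<longleftrightarrow> ys ! i = ys ! j) \<and> ((xs ! i, xs ! j) \<in> R \<longleftrightarrow> (ys ! i, ys ! j) \<in> S))"

lemma same_type_iff_partial_iso:
  "same_type R S xs ys \<longleftrightarrow> length xs = length ys \<and> partial_iso R S (set (zip xs ys))"
  unfolding same_type_def partial_iso_def by (fastforce simp: set_zip)

lemma same_type_sym: "same_type R S xs ys \<Longrightarrow> same_type S R ys xs"
  by (auto simp: same_type_def)

lemma same_type_trans: "same_type R S xs ys \<Longrightarrow> same_type S T ys zs \<Longrightarrow> same_type R T xs zs"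
  by (auto simp: same_type_def)

lemma same_type_take: "same_type R S xs ys \<Longrightarrow> same_type R S (take n xs) (take n ys)"
  by (auto simp: same_type_def)

text \<open>The atomic diagram of the tuple, with variable \<open>i\<close> for the entry
  \<open>xs ! i\<close>. The case \<open>i = j\<close> is included, so the formula also says whether
  an entry is related to itself, and no order axioms are presupposed in a model.\<close>

definition type_fm :: "'a rel \<Rightarrow> 'a list \<Rightarrow> fm" where
  "type_fm R xs = CONJ (\<Union>i<length xs. \<Union>j<length xs.
    {if xs ! i = xs ! j then Eq i j else Neg (Eq i j),
     if (xs ! i, xs ! j) \<in> R then Less i j else Neg (Less i j)})"

lemma type_fm_simps:
  "sat B S w (type_fm R xs) \<longleftrightarrow> same_type R S xs (map w [0..<length xs])"
  "fv (type_fm R xs) \<subseteq> {..<length xs}"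
  "quantifier_free (type_fm R xs)"
proof -
  let ?F = "\<Union>i<length xs. \<Union>j<length xs.
    {if xs ! i = xs ! j then Eq i j else Neg (Eq i j),
     if (xs ! i, xs ! j) \<in> R then Less i j else Neg (Less i j)}"
  have fin: "finite ?F" by blast
  note F = CONJ_simps[OF countable_finite[OF fin]]
  show "sat B S w (type_fm R xs) \<longleftrightarrow> same_type R S xs (map w [0..<length xs])"
    unfolding type_fm_def F by (force simp: same_type_def split: if_splits)
  show "fv (type_fm R xs) \<subseteq> {..<length xs}"
    unfolding type_fm_def F by (auto split: if_splits)
  show "quantifier_free (type_fm R xs)"
    unfolding type_fm_def by (rule F(3)[OF fin]) (auto intro!: quantifier_free.intros)
qed

definition tuples :: "'a set \<Rightarrow> 'a list \<Rightarrow> 'a list set" where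
  "tuples A as = {xs \<in> lists A. length as \<le> length xs \<and> take (length as) xs = as}"

text \<open>
  Variables below \<open>length as\<close> denote the parameters. The first family of axioms says that only the
  types realized in \<open>A\<close> occur; the second one says that every one-point extension of types that is
  realized somewhere in \<open>A\<close> is realized over every tuple of the smaller type.
\<close>

definition realized_fm :: "'a set \<Rightarrow> 'a rel \<Rightarrow> 'a list \<Rightarrow> nat \<Rightarrow> fm" where
  "realized_fm A R as n = foldr Forall [length as..<n]
    (DISJ (type_fm R ` {xs \<in> tuples A as. length xs = n}))"

definition extension_fm :: "'a rel \<Rightarrow> 'a list \<Rightarrow> 'a list \<Rightarrow> 'a \<Rightarrow> fm" where
  "extension_fm R as xs x = foldr Forall [length as..<length xs]
    (DISJ {Neg (type_fm R xs), Exists (length xs) (type_fm R (xs @ [x]))})"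

definition over_parameters_fm :: "'a set \<Rightarrow> 'a rel \<Rightarrow> 'a list \<Rightarrow> fm" where
  "over_parameters_fm A R as = CONJ (realized_fm A R as ` {length as..} \<union>
    (\<Union>xs\<in>tuples A as. extension_fm R as xs ` A))"

text \<open>The one-member disjunction is there because a \<open>Sigma_in\<close> formula of
  positive level has to be a \<open>Disj\<close>.\<close>

definition homogeneous_fm :: "'a set \<Rightarrow> 'a rel \<Rightarrow> 'a list \<Rightarrow> fm" where
  "homogeneous_fm A R as = DISJ {foldr Exists [0..<length as] (over_parameters_fm A R as)}"

context
  fixes A :: "'a set" and R :: "'a rel" and as :: "'a list"
  assumes countable_A: "countable A"
begin

lemma countable_tuples: "countable (tuples A as)"
  by (rule countable_subset[OF _ countable_lists[OF countable_A]]) (auto simp: tuples_def)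

lemma countable_axioms:
  "countable (type_fm R ` {xs \<in> tuples A as. length xs = n})"
  "countable (realized_fm A R as ` {length as..} \<union> (\<Union>xs\<in>tuples A as. extension_fm R as xs ` A))"
  using countable_tuples countable_A by (auto intro: countable_subset[OF _ countable_tuples])

text \<open>Level 1 is reached by the disjunctions of types and by the extension axioms, whose
  implication is written as a disjunction of existential formulas. The universal blocks and their
  conjunction give level 2, and the block that binds the parameters gives level 3.\<close>

lemma Sigma_in_3_homogeneous_fm: "Sigma_in 3 (homogeneous_fm A R as)"
proof -
  have 1: "Sigma_in 1 (DISJ (type_fm R ` {xs \<in> tuples A as. length xs = n}))" for n
  proof (rule Sigma_in_DISJ[OF countable_axioms(1)])
    fix \<phi> assume "\<phi> \<in> type_fm R ` {xs \<in> tuples A as. length xs = n}"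
    then have "Pi_in 0 \<phi> \<and> \<phi> = foldr Exists [] \<phi>"
      by (auto intro: Sigma_in_Pi_in.intros type_fm_simps(3))
    then show "\<exists>m<1. \<exists>xs \<psi>. Pi_in m \<psi> \<and> \<phi> = foldr Exists xs \<psi>" by (metis less_one)
  qed simp
  have 2: "Sigma_in 1 (DISJ {Neg (type_fm R xs), Exists (length xs) (type_fm R (xs @ [x]))})" for xs x
  proof (rule Sigma_in_DISJ)
    fix \<phi> assume "\<phi> \<in> {Neg (type_fm R xs), Exists (length xs) (type_fm R (xs @ [x]))}"
    then have "\<phi> = foldr Exists [] (Neg (type_fm R xs)) \<or>
        \<phi> = foldr Exists [length xs] (type_fm R (xs @ [x]))" by auto
    moreover have "Pi_in 0 (Neg (type_fm R xs))" "Pi_in 0 (type_fm R (xs @ [x]))"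
      by (auto intro!: Sigma_in_Pi_in.intros quantifier_free.intros type_fm_simps(3))
    ultimately show "\<exists>m<1. \<exists>xs \<psi>. Pi_in m \<psi> \<and> \<phi> = foldr Exists xs \<psi>" by (metis less_one)
  qed auto
  have "Pi_in 2 (over_parameters_fm A R as)"
    unfolding over_parameters_fm_def
  proof (rule Pi_in_CONJ[OF countable_axioms(2)])
    fix \<phi> assume "\<phi> \<in> realized_fm A R as ` {length as..} \<union> (\<Union>xs\<in>tuples A as. extension_fm R as xs ` A)"
    then have "\<exists>ys \<psi>. Sigma_in 1 \<psi> \<and> \<phi> = foldr Forall ys \<psi>"
      unfolding realized_fm_def extension_fm_def using 1 2 by blast
    then show "\<exists>m<2. \<exists>ys \<psi>. Sigma_in m \<psi> \<and> \<phi> = foldr Forall ys \<psi>" by (intro exI[of _ 1]) simp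
  qed simp
  then show ?thesis
    unfolding homogeneous_fm_def by (intro Sigma_in_DISJ) (auto intro!: exI[of _ 2])
qed

lemma sentence_homogeneous_fm: "sentence (homogeneous_fm A R as)"
proof -
  have "fv (realized_fm A R as n) \<subseteq> {..<length as}" for n
    using type_fm_simps(2)[of R]
    by (fastforce simp: realized_fm_def fv_foldr DISJ_simps[OF countable_axioms(1)])
  moreover have "fv (extension_fm R as xs x) \<subseteq> {..<length as}" for xs x
    using type_fm_simps(2)[of R xs] type_fm_simps(2)[of R "xs @ [x]"]
    by (fastforce simp: extension_fm_def fv_foldr DISJ_simps)
  ultimately have "fv (over_parameters_fm A R as) \<subseteq> {..<length as}"
    unfolding over_parameters_fm_def CONJ_simps[OF countable_axioms(2)] by blast
  then show ?thesis
    by (auto simp: sentence_def homogeneous_fm_def DISJ_simps fv_foldr)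
qed

lemma sat_over_parameters_fm:
  "sat B S w (over_parameters_fm A R as) \<longleftrightarrow>
    (\<forall>n\<ge>length as. sat B S w (realized_fm A R as n)) \<and>
    (\<forall>xs\<in>tuples A as. \<forall>x\<in>A. sat B S w (extension_fm R as xs x))"
  unfolding over_parameters_fm_def CONJ_simps[OF countable_axioms(2)] by auto

lemma sat_realized_fm:
  "sat B S w (realized_fm A R as n) \<longleftrightarrow>
    (\<forall>w'. (\<forall>i. i < length as \<or> n \<le> i \<longrightarrow> w' i = w i) \<longrightarrow> (\<forall>i\<in>{length as..<n}. w' i \<in> B) \<longrightarrow>
      (\<exists>xs\<in>tuples A as. length xs = n \<and> same_type R S xs (map w' [0..<n])))"
  unfolding realized_fm_def sat_foldr_Forall DISJ_simps[OF countable_axioms(1)]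
  by (simp add: type_fm_simps(1) not_le not_less Bex_def conj_assoc cong: conj_cong)

lemma sat_extension_fm:
  "sat B S w (extension_fm R as xs x) \<longleftrightarrow>
    (\<forall>w'. (\<forall>i. i < length as \<or> length xs \<le> i \<longrightarrow> w' i = w i) \<longrightarrow>
      (\<forall>i\<in>{length as..<length xs}. w' i \<in> B) \<longrightarrow>
      same_type R S xs (map w' [0..<length xs]) \<longrightarrow>
      (\<exists>y\<in>B. same_type R S (xs @ [x]) (map w' [0..<length xs] @ [y])))"
proof -
  have "map (w'(length xs := y)) [0..<length (xs @ [x])] = map w' [0..<length xs] @ [y]" for w' :: "nat \<Rightarrow> 'b" and y
    by auto
  then show ?thesis
    unfolding extension_fm_def sat_foldr_Forall
    by (simp add: DISJ_simps type_fm_simps(1) not_le not_less)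
qed

context
  assumes as: "as \<in> lists A"
    and homogeneous: "\<And>xs ys x. xs \<in> tuples A as \<Longrightarrow> ys \<in> tuples A as \<Longrightarrow> same_type R R xs ys \<Longrightarrow>
      x \<in> A \<Longrightarrow> \<exists>y\<in>A. same_type R R (xs @ [x]) (ys @ [y])"
begin

text \<open>The parameter variables are interpreted by \<open>as\<close> itself. Every tuple over
  them then realizes its own type, and the extension axioms are the assumed homogeneity.\<close>

lemma is_model_homogeneous_fm: "is_model A R (homogeneous_fm A R as)"
proof -
  have "sat A R v (homogeneous_fm A R as)" for v
  proof -
    define w where "w i = (if i < length as then as ! i else v i)" for i
    have tuple: "map w' [0..<n] \<in> tuples A as"
      if w': "\<forall>i. i < length as \<or> n \<le> i \<longrightarrow> w' i = w i" "\<forall>i\<in>{length as..<n}. w' i \<in> A"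
        and n: "length as \<le> n" for w' n
    proof -
      have "w' i \<in> A" if "i < n" for i
        using w' as that by (cases "i < length as") (auto simp: w_def)
      moreover have "take (length as) (map w' [0..<n]) = as"
        using n w'(1) by (intro nth_equalityI) (auto simp: w_def)
      ultimately show ?thesis using n by (auto simp: tuples_def)
    qed
    have "sat A R w (realized_fm A R as n)" if "length as \<le> n" for n
      unfolding sat_realized_fm
    proof clarify
      fix w' assume "\<forall>i. i < length as \<or> n \<le> i \<longrightarrow> w' i = w i" "\<forall>i\<in>{length as..<n}. w' i \<in> A"
      then have "map w' [0..<n] \<in> tuples A as" using tuple that by blast
      moreover have "same_type R R (map w' [0..<n]) (map w' [0..<n])" by (simp add: same_type_def)
      ultimately show "\<exists>xs\<in>tuples A as. length xs = n \<and> same_type R R xs (map w' [0..<n])"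
        by (intro bexI[of _ "map w' [0..<n]"]) auto
    qed
    moreover have "sat A R w (extension_fm R as xs x)" if "xs \<in> tuples A as" "x \<in> A" for xs x
      unfolding sat_extension_fm
    proof clarify
      fix w' assume "\<forall>i. i < length as \<or> length xs \<le> i \<longrightarrow> w' i = w i"
        "\<forall>i\<in>{length as..<length xs}. w' i \<in> A" "same_type R R xs (map w' [0..<length xs])"
      moreover from this have "map w' [0..<length xs] \<in> tuples A as"
        using tuple[of "length xs" w'] that(1) by (auto simp: tuples_def)
      ultimately show "\<exists>y\<in>A. same_type R R (xs @ [x]) (map w' [0..<length xs] @ [y])"
        using homogeneous that by blast
    qed
    ultimately have "sat A R w (over_parameters_fm A R as)" by (simp add: sat_over_parameters_fm)
    then show ?thesis
      unfolding homogeneous_fm_def using as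
      by (auto simp: DISJ_simps sat_foldr_Exists w_def intro!: exI[of _ w])
  qed
  then show ?thesis by (simp add: is_model_def)
qed

text \<open>Back and forth between tuples of the same type over the parameters. Going forth is an
  extension axiom; going back combines the axiom on realized types with homogeneity of
  \<open>A\<close>. Nothing about \<open>S\<close> is assumed beyond the axioms.\<close>

lemma isomorphic_if_is_model_homogeneous_fm:
  assumes "countable B" "is_model B S (homogeneous_fm A R as)"
  shows "isomorphic A R B S"
proof -
  let ?k = "length as"
  obtain w where w: "\<forall>i<?k. w i \<in> B" "sat B S w (over_parameters_fm A R as)"
    using assms(2)
    by (simp add: is_model_def homogeneous_fm_def DISJ_simps sat_foldr_Exists)
      (metis atLeastLessThan_iff zero_le)
  \<comment> \<open>A list is read as a valuation that falls back on \<open>w\<close> past its end,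
    as \<open>sat_realized_fm\<close> and \<open>sat_extension_fm\<close> require.\<close>
  define val where "val ys i = (if i < length ys then ys ! i else w i)" for ys i
  \<comment> \<open>The counterpart in \<open>B\<close> of \<open>tuples A as\<close>, with the
    parameters named by \<open>w\<close>.\<close>
  define T where "T = {ys \<in> lists B. ?k \<le> length ys \<and> (\<forall>i<?k. ys ! i = w i)}"
  have val: "map (val ys) [0..<length ys] = ys" for ys
    by (intro nth_equalityI) (auto simp: val_def)
  have val_params: "\<forall>i. i < ?k \<or> length ys \<le> i \<longrightarrow> val ys i = w i"
    "\<forall>i\<in>{?k..<length ys}. val ys i \<in> B" if "ys \<in> T" for ys
    using that by (auto simp: T_def val_def)
  have realized: "\<exists>xs\<in>tuples A as. same_type R S xs ys" if "ys \<in> T" for ys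
  proof -
    have "sat B S w (realized_fm A R as (length ys))"
      using w(2) that by (simp add: sat_over_parameters_fm T_def)
    then show ?thesis using val_params[OF that] val[of ys] unfolding sat_realized_fm by metis
  qed
  have extension: "\<exists>y\<in>B. same_type R S (xs @ [x]) (ys @ [y])"
    if "ys \<in> T" "xs \<in> tuples A as" "same_type R S xs ys" "x \<in> A" for xs ys x
  proof -
    have "sat B S w (extension_fm R as xs x)"
      using w(2) that by (simp add: sat_over_parameters_fm)
    moreover have "length xs = length ys" using that(3) by (simp add: same_type_def)
    ultimately show ?thesis
      using val_params[OF that(1)] val[of ys] that(3) unfolding sat_extension_fm by metis
  qed
  let ?G = "{set (zip xs ys) | xs ys. xs \<in> tuples A as \<and> ys \<in> T \<and> same_type R S xs ys}"
  have T_snoc: "ys @ [y] \<in> T" if "ys \<in> T" "y \<in> B" for ys y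
    using that by (auto simp: T_def nth_append)
  have tuples_snoc: "xs @ [x] \<in> tuples A as" if "xs \<in> tuples A as" "x \<in> A" for xs x
    using that by (auto simp: tuples_def)
  have zip_snoc: "set (zip (xs @ [x]) (ys @ [y])) = insert (x, y) (set (zip xs ys))"
    if "same_type R S xs ys" for xs ys x y
    using that by (simp add: same_type_def)
  have w_T: "map w [0..<?k] \<in> T" using w(1) by (auto simp: T_def)
  then obtain xs\<^sub>0 where "xs\<^sub>0 \<in> tuples A as" "same_type R S xs\<^sub>0 (map w [0..<?k])"
    using realized by blast
  then have "set (zip xs\<^sub>0 (map w [0..<?k])) \<in> ?G" using w_T by blast
  then show ?thesis
  proof (rule isomorphic_back_and_forth[OF countable_A assms(1)])
    fix g assume "g \<in> ?G"
    then show "g \<subseteq> A \<times> B \<and> partial_iso R S g"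
      by (auto simp: same_type_iff_partial_iso tuples_def T_def dest: set_zip_leftD set_zip_rightD)
  next
    fix g x assume "g \<in> ?G" "x \<in> A"
    then obtain xs ys where g: "g = set (zip xs ys)" "xs \<in> tuples A as" "ys \<in> T" "same_type R S xs ys"
      by blast
    then obtain y where "y \<in> B" "same_type R S (xs @ [x]) (ys @ [y])"
      using extension \<open>x \<in> A\<close> by blast
    then show "\<exists>y. insert (x, y) g \<in> ?G"
      using g T_snoc tuples_snoc \<open>x \<in> A\<close> zip_snoc[OF g(4), of x y, symmetric] by blast
  next
    fix g y assume "g \<in> ?G" "y \<in> B"
    then obtain xs ys where g: "g = set (zip xs ys)" "xs \<in> tuples A as" "ys \<in> T" "same_type R S xs ys"
      by blast
    \<comment> \<open>The type of \<open>ys @ [y]\<close> occurs in \<open>A\<close>, but at a tuple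
      that need not begin with \<open>xs\<close>. Homogeneity replaces its last entry by one that
      fits over \<open>xs\<close>.\<close>
    obtain us where us: "us \<in> tuples A as" "same_type R S us (ys @ [y])"
      using realized T_snoc[OF g(3) \<open>y \<in> B\<close>] by blast
    have len: "length us = Suc (length ys)" using us(2) by (simp add: same_type_def)
    then obtain zs z where us_eq: "us = zs @ [z]" by (metis length_Suc_conv_rev)
    have len': "length zs = length ys" using len us_eq by simp
    have zs: "zs \<in> tuples A as" "z \<in> A"
      using us(1) us_eq len' g(3) by (auto simp: tuples_def T_def)
    have "same_type R S zs ys"
      using same_type_take[OF us(2), of "length ys"] us_eq len' by simp
    then have "same_type R R zs xs" using g(4) same_type_sym same_type_trans by blast
    then obtain x where x: "x \<in> A" "same_type R R (zs @ [z]) (xs @ [x])"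
      using homogeneous zs g(2) by blast
    then have "same_type R S (xs @ [x]) (ys @ [y])"
      using us(2) us_eq same_type_sym same_type_trans by blast
    then show "\<exists>x. insert (x, y) g \<in> ?G"
      using g T_snoc[OF g(3) \<open>y \<in> B\<close>] tuples_snoc[OF g(2) x(1)] zip_snoc[OF g(4), of x y, symmetric] by blast
  qed
qed

lemma scott_sentence_homogeneous_fm: "scott_sentence A R (homogeneous_fm A R as)"
  unfolding scott_sentence_def
proof (intro conjI allI impI iffI)
  fix B :: "nat set" and S
  assume "is_model B S (homogeneous_fm A R as)"
  then show "isomorphic A R B S" by (intro isomorphic_if_is_model_homogeneous_fm) auto
next
  fix B :: "nat set" and S
  assume "isomorphic A R B S"
  then show "is_model B S (homogeneous_fm A R as)"
    using is_model_isomorphic[OF sentence_homogeneous_fm] is_model_homogeneous_fm by blast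
qed (rule sentence_homogeneous_fm)

end

end

text \<open>With \<open>ends A R\<close> as parameters nothing blocks an extension any more, so
  tuples of the same type over them extend alike.\<close>

lemma scott_sentence_if_finite_adjacency:
  assumes "countable A" "strict_linear_order_on A R" "finite (adjacency A R)"
  shows "\<exists>\<phi>. Sigma_in 3 \<phi> \<and> scott_sentence A R \<phi>"
proof -
  obtain as where as: "set as = ends A R"
    using finite_list[OF finite_ends[OF assms(2,3)]] by blast
  have lists: "as \<in> lists A" using as by (auto simp: ends_def adjacency_def Field_def)
  have "scott_sentence A R (homogeneous_fm A R as)"
  proof (rule scott_sentence_homogeneous_fm[OF assms(1) lists])
    fix xs ys x
    assume xs: "xs \<in> tuples A as" and ys: "ys \<in> tuples A as" and same: "same_type R R xs ys"
      and x: "x \<in> A"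
    \<comment> \<open>Both tuples begin with the parameters, so zipping them pairs each parameter
      with itself.\<close>
    have "Id_on (set as) \<subseteq> set (zip xs ys)"
    proof
      fix p assume "p \<in> Id_on (set as)"
      then obtain i where i: "i < length as" "p = (as ! i, as ! i)" by (auto simp: in_set_conv_nth)
      then have "xs ! i = as ! i" "ys ! i = as ! i" "i < length xs" "i < length ys"
        using xs ys by (auto simp: tuples_def) (metis nth_take)+
      then show "p \<in> set (zip xs ys)" using i(2) by (force simp: set_zip)
    qed
    then have "set (zip xs ys) \<in> partial_isos A R A R (Id_on (set as))"
      using xs ys same
      by (auto simp: partial_isos_def tuples_def same_type_iff_partial_iso
          dest: set_zip_leftD set_zip_rightD)
    then obtain y where "insert (x, y) (set (zip xs ys)) \<in> partial_isos A R A R (Id_on (set as))"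
      using partial_isos_extend_self[OF assms(2) _ _ x] as by blast
    then show "\<exists>y\<in>A. same_type R R (xs @ [x]) (ys @ [y])"
      using same by (intro bexI[of _ y]) (auto simp: partial_isos_def same_type_iff_partial_iso)
  qed
  then show ?thesis using Sigma_in_3_homogeneous_fm[OF assms(1)] by blast
qed

section \<open>Replacing infinite cells by the rationals\<close>

text \<open>The two chains are matched from the top, greatest element with greatest element.\<close>

lemma finite_chain_embeds:
  fixes Q :: "'b::linorder set"
  assumes "strict_linear_order_on A R" "finite Q" "finite T" "T \<subseteq> A" "card T = card Q"
  shows "\<exists>e. (\<forall>q\<in>Q. e q \<in> T) \<and> (\<forall>q\<in>Q. \<forall>q'\<in>Q. q < q' \<longrightarrow> (e q, e q') \<in> R)"
  using assms(2-5)
proof (induction Q arbitrary: T rule: finite_linorder_max_induct)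
  case empty
  then show ?case by simp
next
  case (insert b Q)
  then have "T \<noteq> {}" by auto
  then obtain t where t: "t \<in> T" "\<forall>x\<in>T. x = t \<or> (x, t) \<in> R"
    using strict_linear_order_on_finite_greatest[OF assms(1)] insert.prems by blast
  have "b \<notin> Q" using insert.hyps by blast
  then have "card (T - {t}) = card Q" using insert t(1) by simp
  then obtain e where e: "\<forall>q\<in>Q. e q \<in> T - {t}" "\<forall>q\<in>Q. \<forall>q'\<in>Q. q < q' \<longrightarrow> (e q, e q') \<in> R"
    using insert.IH[of "T - {t}"] insert.prems by auto
  have "(\<forall>q\<in>insert b Q. (e(b := t)) q \<in> T) \<and>
      (\<forall>q\<in>insert b Q. \<forall>q'\<in>insert b Q. q < q' \<longrightarrow> ((e(b := t)) q, (e(b := t)) q') \<in> R)"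
    using e t insert.hyps(2) \<open>b \<notin> Q\<close> by (auto dest: less_asym)
  then show ?case by blast
qed

lemma infinite_chain_embeds:
  fixes Q :: "'b::linorder set"
  assumes "strict_linear_order_on A R" "finite Q" "infinite X" "X \<subseteq> A"
  shows "\<exists>e. (\<forall>q\<in>Q. e q \<in> X) \<and> (\<forall>q\<in>Q. \<forall>q'\<in>Q. q < q' \<longrightarrow> (e q, e q') \<in> R)"
proof -
  obtain T where T: "finite T" "card T = card Q" "T \<subseteq> X"
    using infinite_arbitrarily_large[OF assms(3)] by blast
  then show ?thesis using finite_chain_embeds[OF assms(1,2) T(1) _ T(2)] assms(4) by blast
qed

text \<open>An invariant of the cell of \<open>x\<close>. The second component separates a parameter
  from the points just below it, which have the same parameters below them; thus each parameter is a
  cell of its own.\<close>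

definition cut :: "'a rel \<Rightarrow> 'a set \<Rightarrow> 'a \<Rightarrow> 'a set \<times> 'a set" where
  "cut R P x = ({p \<in> P. (p, x) \<in> R}, {p \<in> P. p = x})"

definition small :: "'a set \<Rightarrow> 'a rel \<Rightarrow> 'a set \<Rightarrow> 'a set" where
  "small A R P = {x \<in> A. finite {y \<in> A. cut R P y = cut R P x}}"

text \<open>
  The order obtained by replacing every infinite cell of the partition induced by the parameters
  with a copy of the rationals, tagged with a representative of the cell; finite cells are kept.
\<close>

definition inflate :: "'a set \<Rightarrow> 'a rel \<Rightarrow> 'a set \<Rightarrow> ('a \<times> rat) set" where
  "inflate A R P = {(r, q). r \<in> small A R P \<and> q = 0 \<or>
    r \<in> inv_into A (cut R P) ` cut R P ` A \<and> r \<notin> small A R P}"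

definition inflate_less :: "'a set \<Rightarrow> 'a rel \<Rightarrow> 'a set \<Rightarrow> ('a \<times> rat) rel" where
  "inflate_less A R P = {((r, q), (r', q')). (r, q) \<in> inflate A R P \<and> (r', q') \<in> inflate A R P \<and>
    ((r, r') \<in> R \<or> r = r' \<and> q < q')}"

text \<open>All points of finite cells are anchored, not only the parameters, because the
  adjacencies among them survive in the inflated order.\<close>

definition anchors :: "'a set \<Rightarrow> 'a rel \<Rightarrow> 'a set \<Rightarrow> ('a \<times> 'a \<times> rat) set" where
  "anchors A R P = (\<lambda>k. (k, (k, 0))) ` small A R P"

context
  fixes A :: "'a set" and R :: "'a rel" and P :: "'a set"
  assumes lin: "strict_linear_order_on A R" and finite_P: "finite P" and P_sub: "P \<subseteq> A"
begin

text \<open>Points of different cells are separated by a parameter \<open>p\<close> with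
  \<open>x \<le> p \<le> y\<close>, and the cuts carry this over to \<open>x'\<close> and
  \<open>y'\<close>.\<close>

lemma cut_less:
  assumes "x \<in> A" "y \<in> A" "x' \<in> A" "y' \<in> A" "cut R P x' = cut R P x" "cut R P y' = cut R P y"
    and "cut R P x \<noteq> cut R P y" "(x, y) \<in> R"
  shows "(x', y') \<in> R"
proof -
  note ord = strict_linear_order_onD[OF lin]
  have "\<exists>p\<in>P. (p, x) \<notin> R \<and> ((p, y) \<in> R \<or> p = y)"
  proof (rule ccontr)
    assume contr: "\<not> ?thesis"
    have "(p, x) \<in> R \<longleftrightarrow> (p, y) \<in> R" "p = x \<longleftrightarrow> p = y" if "p \<in> P" for p
      using contr that assms(8) ord(1)[of p x y] ord(2)[of p] ord(1)[of x y x] by blast+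
    then have "cut R P x = cut R P y" unfolding cut_def by blast
    then show False using assms(7) by blast
  qed
  then obtain p where p: "p \<in> P" "(p, x) \<notin> R" "(p, y) \<in> R \<or> p = y" by blast
  have "(p, x') \<notin> R" using p(1,2) assms(5) unfolding cut_def by blast
  moreover have "(p, y') \<in> R \<or> p = y'" using p(1,3) assms(6) unfolding cut_def by blast
  moreover have "x' \<noteq> y'" using assms(5-7) by metis
  ultimately show ?thesis using ord(1)[of x' p y'] ord(3)[of x' p] p(1) P_sub assms(3) by blast
qed

lemma finite_cuts: "finite (cut R P ` A)"
  by (rule finite_subset[of _ "Pow P \<times> Pow P"]) (auto simp: cut_def finite_P)

lemma small_cong: "x \<in> A \<Longrightarrow> y \<in> A \<Longrightarrow> cut R P x = cut R P y \<Longrightarrow> x \<in> small A R P \<longleftrightarrow> y \<in> small A R P"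
  by (simp add: small_def)

lemma small_sub: "small A R P \<subseteq> A"
  by (auto simp: small_def)

lemma finite_small: "finite (small A R P)"
proof (rule finite_subset)
  show "small A R P \<subseteq> (\<Union>c\<in>cut R P ` small A R P. {y \<in> A. cut R P y = c})"
    by (auto simp: small_def)
  have "finite (cut R P ` small A R P)"
    by (rule finite_subset[OF image_mono[OF small_sub] finite_cuts])
  then show "finite (\<Union>c\<in>cut R P ` small A R P. {y \<in> A. cut R P y = c})"
    by (rule finite_UN_I) (auto simp: small_def)
qed

lemma P_sub_small: "P \<subseteq> small A R P"
proof
  fix p assume p: "p \<in> P"
  have "y = p" if "cut R P y = cut R P p" for y
  proof -
    have "p \<in> snd (cut R P y)" unfolding that using p by (simp add: cut_def)
    then show ?thesis by (simp add: cut_def)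
  qed
  then have "{y \<in> A. cut R P y = cut R P p} \<subseteq> {p}" by auto
  then have "finite {y \<in> A. cut R P y = cut R P p}" by (rule finite_subset) simp
  then show "p \<in> small A R P" using p P_sub by (auto simp: small_def)
qed

lemma inflate_fst: "(r, q) \<in> inflate A R P \<Longrightarrow> r \<in> A"
  using small_sub by (auto simp: inflate_def inv_into_into)

text \<open>The tags of infinite cells are values of \<open>inv_into\<close>, which picks one
  representative per cell.\<close>

lemma inflate_eq_if_cut_eq:
  assumes "(r, q) \<in> inflate A R P" "(r', q') \<in> inflate A R P" "r \<notin> small A R P" "r' \<notin> small A R P"
    and "cut R P r = cut R P r'"
  shows "r = r'"
  using assms by (auto simp: inflate_def f_inv_into_f)

lemma inflate_any:
  "(r, q) \<in> inflate A R P \<Longrightarrow> r \<notin> small A R P \<Longrightarrow> (r, q') \<in> inflate A R P"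
  by (auto simp: inflate_def)

text \<open>Every cell survives in the inflated order. The coordinate 0 is forced for finite cells
  and an arbitrary choice for infinite ones.\<close>

lemma inflate_represents:
  assumes "x \<in> A"
  shows "\<exists>r. (r, 0) \<in> inflate A R P \<and> cut R P r = cut R P x \<and> (x \<in> small A R P \<longrightarrow> r = x)"
proof (cases "x \<in> small A R P")
  case True
  then show ?thesis by (auto simp: inflate_def)
next
  case False
  let ?r = "inv_into A (cut R P) (cut R P x)"
  have "?r \<in> A" "cut R P ?r = cut R P x"
    using assms by (auto simp: inv_into_into f_inv_into_f)
  then show ?thesis using False small_cong[OF assms] assms by (auto simp: inflate_def)
qed

text \<open>A Scott sentence controls countable models only, hence the need for this. There are
  finitely many tags.\<close>

lemma countable_inflate: "countable (inflate A R P)"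
proof (rule countable_subset)
  let ?F = "small A R P \<union> inv_into A (cut R P) ` cut R P ` A"
  show "inflate A R P \<subseteq> ?F \<times> UNIV" by (auto simp: inflate_def)
  show "countable (?F \<times> (UNIV :: rat set))"
    using finite_small finite_cuts by (intro countable_SIGMA) (auto intro: countable_finite)
qed

lemma strict_linear_order_inflate: "strict_linear_order_on (inflate A R P) (inflate_less A R P)"
proof -
  note ord = strict_linear_order_onD[OF lin]
  have "trans (inflate_less A R P)"
  proof (rule transI)
    fix x y z assume "(x, y) \<in> inflate_less A R P" "(y, z) \<in> inflate_less A R P"
    then show "(x, z) \<in> inflate_less A R P"
      using ord(1)[of "fst x" "fst y" "fst z"]
      by (cases x; cases y; cases z) (auto simp: inflate_less_def)
  qed
  moreover have "irrefl (inflate_less A R P)"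
    using ord(2) by (auto simp: irrefl_def inflate_less_def)
  moreover have "total_on (inflate A R P) (inflate_less A R P)"
    unfolding total_on_def
  proof clarify
    fix r q r' q'
    assume *: "(r, q) \<in> inflate A R P" "(r', q') \<in> inflate A R P"
      "((r', q'), (r, q)) \<notin> inflate_less A R P" and ne: "\<not> (r = r' \<and> q = q')"
    show "((r, q), (r', q')) \<in> inflate_less A R P"
      using * ne ord(3)[OF inflate_fst[OF *(1)] inflate_fst[OF *(2)]] by (auto simp: inflate_less_def)
  qed
  ultimately show ?thesis by (simp add: strict_linear_order_on_def)
qed

lemma inflate_step:
  assumes "(r, q) \<in> inflate A R P" "r \<notin> small A R P"
  shows "((r, q), (r, q + 1)) \<in> inflate_less A R P" "((r, q - 1), (r, q)) \<in> inflate_less A R P"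
  using assms inflate_any[OF assms] by (auto simp: inflate_less_def)

text \<open>Within one copy the rationals are dense. Between different tags, a shift by 1 inside the
  copy that belongs to an infinite cell stays between the two points.\<close>

lemma inflate_dense:
  assumes "((r, q), (r', q')) \<in> inflate_less A R P" "r \<notin> small A R P \<or> r' \<notin> small A R P"
  shows "\<exists>z\<in>inflate A R P. ((r, q), z) \<in> inflate_less A R P \<and> (z, (r', q')) \<in> inflate_less A R P"
proof -
  have mem: "(r, q) \<in> inflate A R P" "(r', q') \<in> inflate A R P"
    using assms(1) by (auto simp: inflate_less_def)
  show ?thesis
  proof (cases "r = r'")
    case True
    then have "q < q'" using assms(1) strict_linear_order_onD(2)[OF lin] by (auto simp: inflate_less_def)
    then obtain s where "q < s" "s < q'" using dense by blast
    then show ?thesis using True mem inflate_any[OF mem(1), of s] assms(2)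
      by (intro bexI[of _ "(r, s)"]) (auto simp: inflate_less_def)
  next
    case False
    then have less: "(r, r') \<in> R" using assms(1) by (auto simp: inflate_less_def)
    show ?thesis
    proof (cases "r \<in> small A R P")
      case True
      then show ?thesis using less mem inflate_any[OF mem(2), of "q' - 1"] assms(2)
        by (intro bexI[of _ "(r', q' - 1)"]) (auto simp: inflate_less_def)
    next
      case False
      then show ?thesis using less mem inflate_any[OF mem(1), of "q + 1"]
        by (intro bexI[of _ "(r, q + 1)"]) (auto simp: inflate_less_def)
    qed
  qed
qed

text \<open>A point of a rational copy has points of the copy on both sides and, by density, no
  neighbours. Only the points of finite cells remain.\<close>

lemma ends_inflate: "ends (inflate A R P) (inflate_less A R P) \<subseteq> Range (anchors A R P)"
proof -
  have "r \<in> small A R P" if rq: "(r, q) \<in> ends (inflate A R P) (inflate_less A R P)" for r q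
  proof (rule ccontr)
    assume r: "r \<notin> small A R P"
    have mem: "(r, q) \<in> inflate A R P" using rq by (auto simp: ends_def adjacency_def Field_def)
    then have "\<exists>z\<in>inflate A R P. (z, (r, q)) \<in> inflate_less A R P"
      "\<exists>z\<in>inflate A R P. ((r, q), z) \<in> inflate_less A R P"
      using inflate_step[OF mem r] inflate_any[OF mem r] by blast+
    then have "(r, q) \<in> Field (adjacency (inflate A R P) (inflate_less A R P))"
      using rq unfolding ends_def by blast
    then obtain r' q' where
      "((r, q), (r', q')) \<in> adjacency (inflate A R P) (inflate_less A R P) \<or>
       ((r', q'), (r, q)) \<in> adjacency (inflate A R P) (inflate_less A R P)"
      unfolding Field_def by auto
    then show False
      using inflate_dense[of r q r' q'] inflate_dense[of r' q' r q] r unfolding adjacency_def by blast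
  qed
  moreover have "q = 0" if "(r, q) \<in> inflate A R P" "r \<in> small A R P" for r q
    using that by (auto simp: inflate_def)
  moreover have "ends (inflate A R P) (inflate_less A R P) \<subseteq> inflate A R P"
    by (auto simp: ends_def adjacency_def Field_def)
  ultimately show ?thesis by (force simp: anchors_def)
qed

lemma finite_adjacency_inflate: "finite (adjacency (inflate A R P) (inflate_less A R P))"
proof (rule finite_subset)
  let ?E = "Range (anchors A R P)"
  show "adjacency (inflate A R P) (inflate_less A R P) \<subseteq> ?E \<times> ?E"
    using ends_inflate unfolding ends_def Field_def by fast
  show "finite (?E \<times> ?E)" using finite_small by (simp add: anchors_def finite_Range)
qed

text \<open>The representative of the cell of \<open>x\<close> plays the role of
  \<open>y\<^sub>0\<close> in \<open>partial_isos_extend\<close>.\<close>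

lemma partial_isos_inflate_extend:
  assumes "g \<in> partial_isos A R (inflate A R P) (inflate_less A R P) (anchors A R P)" "x \<in> A"
  shows "\<exists>y. insert (x, y) g \<in> partial_isos A R (inflate A R P) (inflate_less A R P) (anchors A R P)"
proof -
  obtain r where r: "(r, 0) \<in> inflate A R P" "cut R P r = cut R P x" "x \<in> small A R P \<longrightarrow> r = x"
    using inflate_represents[OF assms(2)] by blast
  have rA: "r \<in> A" using inflate_fst[OF r(1)] .
  \<comment> \<open>If \<open>x\<close> lies in an infinite cell, each anchored point lies in
    another cell, so \<open>cut_less\<close> applies; otherwise \<open>r = x\<close>.\<close>
  have "((k, x) \<in> R \<longrightarrow> (k, r) \<in> R) \<and> ((x, k) \<in> R \<longrightarrow> (r, k) \<in> R)" if k: "k \<in> small A R P" for k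
  proof (cases "x \<in> small A R P")
    case False
    have kA: "k \<in> A" using k small_sub by blast
    then have "cut R P k \<noteq> cut R P x" using False k small_cong[OF kA assms(2)] by blast
    then show ?thesis
      using cut_less[OF kA assms(2) kA rA] cut_less[OF assms(2) kA rA kA] r(2) by metis
  qed (use r(3) in simp)
  moreover have "(k, 0) \<in> inflate A R P" if "k \<in> small A R P" for k
    using that by (simp add: inflate_def)
  ultimately show ?thesis
    using r(1)
    by (intro partial_isos_extend[OF lin strict_linear_order_inflate ends_inflate assms, of "(r, 0)"])
      (auto simp: anchors_def inflate_less_def)
qed

text \<open>All preimages are chosen at once: an infinite cell contains chains of every finite
  length, hence room for the finitely many rationals that occur.\<close>

lemma partial_isos_inflate_cover:
  assumes "finite W" "W \<subseteq> inflate A R P"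
  shows "\<exists>g\<in>partial_isos A R (inflate A R P) (inflate_less A R P) (anchors A R P). W \<subseteq> Range g"
proof -
  note ordA = strict_linear_order_onD[OF lin]
  note ordB = strict_linear_order_onD[OF strict_linear_order_inflate]
  \<comment> \<open>The anchored points are added so that the map extends
    \<open>anchors A R P\<close>.\<close>
  define V where "V = W \<union> (\<lambda>k. (k, 0)) ` small A R P"
  have V: "finite V" "V \<subseteq> inflate A R P"
    using assms finite_small by (auto simp: V_def inflate_def)
  \<comment> \<open>For simplicity each infinite cell receives all second coordinates of
    \<open>V\<close>, including those that occur only with other tags.\<close>
  have "\<exists>e. (\<forall>q\<in>snd ` V. e q \<in> {y \<in> A. cut R P y = cut R P r}) \<and>
      (\<forall>q\<in>snd ` V. \<forall>q'\<in>snd ` V. q < q' \<longrightarrow> (e q, e q') \<in> R)"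
    if "r \<in> A - small A R P" for r
    by (rule infinite_chain_embeds[OF lin]) (use that V(1) in \<open>auto simp: small_def\<close>)
  then obtain e where e: "\<And>r. r \<in> A - small A R P \<Longrightarrow>
      (\<forall>q\<in>snd ` V. e r q \<in> {y \<in> A. cut R P y = cut R P r}) \<and>
      (\<forall>q\<in>snd ` V. \<forall>q'\<in>snd ` V. q < q' \<longrightarrow> (e r q, e r q') \<in> R)" by metis
  define f where "f = (\<lambda>(r, q). if r \<in> small A R P then r else e r q)"
  have f: "f (r, q) \<in> A" "cut R P (f (r, q)) = cut R P r" if rq: "(r, q) \<in> V" for r q
  proof -
    have "r \<in> A" using inflate_fst V(2) rq by blast
    moreover have "q \<in> snd ` V" using rq by force
    ultimately show "f (r, q) \<in> A" "cut R P (f (r, q)) = cut R P r"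
      using e[of r] by (auto simp: f_def)
  qed
  have mono: "(f (r, q), f (r', q')) \<in> R"
    if rq: "(r, q) \<in> V" "(r', q') \<in> V" and less: "((r, q), (r', q')) \<in> inflate_less A R P" for r q r' q'
  proof (cases "cut R P r = cut R P r'")
    case False
    then have "(r, r') \<in> R" using less by (auto simp: inflate_less_def)
    then show ?thesis
      using cut_less[of r r' "f (r, q)" "f (r', q')"] f rq inflate_fst V(2) False by blast
  next
    case True
    have mem: "(r, q) \<in> inflate A R P" "(r', q') \<in> inflate A R P" using rq V(2) by auto
    have A: "r \<in> A" "r' \<in> A" using mem inflate_fst by auto
    show ?thesis
    proof (cases "r \<in> small A R P")
      case small: True
      then have small': "r' \<in> small A R P" using small_cong[OF A True] by blast
      then have "q = 0" "q' = 0" using small mem by (auto simp: inflate_def)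
      then have "(r, r') \<in> R" using less by (auto simp: inflate_less_def)
      then show ?thesis using small small' by (simp add: f_def)
    next
      case large: False
      then have large': "r' \<notin> small A R P" using small_cong[OF A True] by blast
      then have "r = r'" using inflate_eq_if_cut_eq[OF mem large _ True] by blast
      then have "q < q'" using less ordA(2) by (auto simp: inflate_less_def)
      moreover have "q \<in> snd ` V" "q' \<in> snd ` V" using rq by force+
      ultimately show ?thesis using e[of r] A(1) large \<open>r = r'\<close> by (auto simp: f_def)
    qed
  qed
  \<comment> \<open>A strictly monotone map between linear orders is injective and reflects the
    order.\<close>
  have iff: "(f v = f w \<longleftrightarrow> v = w) \<and> ((f v, f w) \<in> R \<longleftrightarrow> (v, w) \<in> inflate_less A R P)"
    if vw: "v \<in> V" "w \<in> V" for v w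
  proof -
    have "v = w \<or> (v, w) \<in> inflate_less A R P \<or> (w, v) \<in> inflate_less A R P"
      using ordB(3) vw V(2) by blast
    moreover have "(f v, f w) \<in> R" if "(v, w) \<in> inflate_less A R P"
      using mono that vw by (metis surj_pair)
    moreover have "(f w, f v) \<in> R" if "(w, v) \<in> inflate_less A R P"
      using mono that vw by (metis surj_pair)
    ultimately show ?thesis
      using ordA(1)[of "f v" "f w" "f v"] ordA(2) ordB(1)[of v w v] ordB(2) by metis
  qed
  let ?g = "(\<lambda>w. (f w, w)) ` V"
  have "partial_iso R (inflate_less A R P) ?g"
    using iff by (auto simp: partial_iso_def)
  moreover have "anchors A R P \<subseteq> ?g"
    by (auto simp: anchors_def V_def f_def image_iff)
  moreover have "?g \<subseteq> A \<times> inflate A R P" using f V(2) by auto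
  ultimately have "?g \<in> partial_isos A R (inflate A R P) (inflate_less A R P) (anchors A R P)"
    using V(1) by (simp add: partial_isos_def)
  moreover have "W \<subseteq> Range ?g" by (auto simp: V_def)
  ultimately show ?thesis by blast
qed

lemma sat_inflate:
  assumes "Pi_in m \<psi>" "m \<le> 2" "\<forall>z\<in>fv \<psi>. v z \<in> P \<and> w z = (v z, 0)" "sat A R v \<psi>"
  shows "sat (inflate A R P) (inflate_less A R P) w \<psi>"
proof (rule Pi_in_2_transfer[OF assms(1,2) partial_isos_inflate_extend partial_isos_inflate_cover _ assms(4)])
  show "\<forall>z\<in>fv \<psi>. (v z, w z) \<in> anchors A R P"
    using assms(3) P_sub_small by (auto simp: anchors_def)
qed

end

section \<open>From a \<open>Sigma_in 3\<close> Scott sentence to finitely many adjacencies\<close>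

lemma isomorphic_refl: "isomorphic A R A R"
  unfolding isomorphic_def by (rule exI[of _ id]) simp

lemma finite_adjacency_isomorphic:
  assumes "isomorphic A R B S" "finite (adjacency B S)"
  shows "finite (adjacency A R)"
proof -
  obtain f where f: "bij_betw f A B" "\<forall>x\<in>A. \<forall>y\<in>A. (x, y) \<in> R \<longleftrightarrow> (f x, f y) \<in> S"
    using assms(1) by (auto simp: isomorphic_def)
  have B: "B = f ` A" and inj: "inj_on f A" using f(1) by (auto simp: bij_betw_def)
  have "map_prod f f ` adjacency A R \<subseteq> adjacency B S"
    using f(2) by (auto simp: adjacency_def B)
  then have "finite (map_prod f f ` adjacency A R)" using assms(2) finite_subset by blast
  moreover have "inj_on (map_prod f f) (adjacency A R)"
    by (rule inj_on_subset[OF map_prod_inj_on[OF inj inj]]) (auto simp: adjacency_def)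
  ultimately show ?thesis using finite_imageD by blast
qed

lemma finite_adjacency_if_scott_sentence:
  assumes "countable A" "strict_linear_order_on A R" "Sigma_in 3 \<phi>" "scott_sentence A R \<phi>"
  shows "finite (adjacency A R)"
proof -
  have model: "is_model A R \<phi>"
    using scott_sentence_iff[OF assms(4,1)] isomorphic_refl by blast
  obtain I \<Phi> where \<phi>: "\<phi> = Disj I \<Phi>"
    "\<And>i. i \<in> I \<Longrightarrow> \<exists>m<3. \<exists>xs \<psi>. Pi_in m \<psi> \<and> \<Phi> i = foldr Exists xs \<psi>"
    using assms(3) by (cases rule: Sigma_in.cases) auto
  then obtain i where i: "i \<in> I" "sat A R undefined (\<Phi> i)"
    using model by (auto simp: is_model_def)
  then obtain m xs \<psi> where \<psi>: "m < 3" "Pi_in m \<psi>" "\<Phi> i = foldr Exists xs \<psi>"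
    using \<phi>(2) by blast
  then obtain v where v: "\<forall>x\<in>set xs. v x \<in> A" "sat A R v \<psi>"
    using i(2) by (auto simp: sat_foldr_Exists)
  \<comment> \<open>Since the whole formula is a sentence, the block \<open>xs\<close> binds every
    free variable of \<open>\<psi>\<close>, and its witnesses are all the parameters there
    are.\<close>
  have "fv (\<Phi> i) = {}" using assms(4) \<phi>(1) i(1) by (auto simp: scott_sentence_def sentence_def)
  then have fv: "fv \<psi> \<subseteq> set xs" using \<psi>(3) by (simp add: fv_foldr)
  let ?P = "v ` set xs"
  have P: "finite ?P" "?P \<subseteq> A" using v(1) by auto
  let ?B = "inflate A R ?P" and ?S = "inflate_less A R ?P"
  \<comment> \<open>The witnesses become \<open>(v x, 0)\<close>; these exist in the inflated order
    because parameters form finite cells. The valuation \<open>u\<close> is arbitrary, as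
    \<open>is_model\<close> demands.\<close>
  have "sat ?B ?S u (\<Phi> i)" for u
  proof -
    define w where "w x = (if x \<in> set xs then (v x, 0) else u x)" for x
    have "sat ?B ?S w \<psi>"
      by (rule sat_inflate[OF assms(2) P \<psi>(2) _ _ v(2)]) (use \<psi>(1) fv in \<open>auto simp: w_def\<close>)
    moreover have "\<forall>x\<in>set xs. w x \<in> ?B"
      using P_sub_small[OF assms(2) P] by (auto simp: w_def inflate_def)
    ultimately show ?thesis
      unfolding \<psi>(3) sat_foldr_Exists by (intro exI[of _ w]) (simp add: w_def)
  qed
  then have "is_model ?B ?S \<phi>" using \<phi>(1) i(1) by (auto simp: is_model_def)
  then have "isomorphic A R ?B ?S"
    using scott_sentence_iff[OF assms(4) countable_inflate[OF assms(2) P]] by blast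
  then show ?thesis
    using finite_adjacency_isomorphic finite_adjacency_inflate[OF assms(2) P] by blast
qed

theorem mainTheorem9:
  fixes L :: "'a set" and R :: "'a rel"
  assumes "countable L" and "R \<subseteq> L \<times> L" and "strict_linear_order_on L R"
  shows "(\<exists>\<phi>. Sigma_in 3 \<phi> \<and> scott_sentence L R \<phi>) \<longleftrightarrow> finite (adjacency L R)"
  using finite_adjacency_if_scott_sentence[OF assms(1,3)] scott_sentence_if_finite_adjacency[OF assms(1,3)]
  by blast

end
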